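(* There exist absolute constants $c,C>0$ such that, for every $n\geq2$ and every real $p>0$, $$ c\sqrt{\frac{\ln\left(e+\frac{n}{1+p}\right)}n}\leq M_{-p}(B_\infty^n)\leq C\sqrt{\frac{\ln\left(e+\frac{n}{1+p}\right)}n}. $$
   Context: $B_\infty^n=[-1,1]^n$. With $\sigma$ the rotationally invariant probability measure on $S^{n-1}$ and $\|\theta\|_\infty=\max_i|\theta_i|$, for $p>0$, $$ M_{-p}(B_\infty^n)=\left(\int_{S^{n-1}}\|\theta\|_\infty^{-p}\,d\sigma(\theta)\right)^{-1/p}. $$ *)

theory Defs
  imports "HOL-Probability.Probability"
begin

text \<open>
  The dimension is quantified inside the statement (the constants must not depend on it), so
  points of \<open>\<real>\<^sup>n\<close> are extensional functions on \<open>{..<n}\<close>; the product sigma-algebra of the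
  Borel sets on \<open>{..<n}\<close> is the Borel sigma-algebra of \<open>\<real>\<^sup>n\<close>.
\<close>

definition unit_sphere :: "nat \<Rightarrow> (nat \<Rightarrow> real) set" where
  "unit_sphere n = {x \<in> {..<n} \<rightarrow>\<^sub>E UNIV. sqrt (\<Sum>i<n. (x i)\<^sup>2) = 1}"

definition sup_norm :: "nat \<Rightarrow> (nat \<Rightarrow> real) \<Rightarrow> real" where
  "sup_norm n x = Max ((\<lambda>i. \<bar>x i\<bar>) ` {..<n})"

definition orthogonal_mat :: "nat \<Rightarrow> (nat \<Rightarrow> nat \<Rightarrow> real) \<Rightarrow> bool" where
  "orthogonal_mat n U \<longleftrightarrow>
     (\<forall>i<n. \<forall>j<n. (\<Sum>k<n. U k i * U k j) = (if i = j then 1 else 0))"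

definition mat_apply :: "nat \<Rightarrow> (nat \<Rightarrow> nat \<Rightarrow> real) \<Rightarrow> (nat \<Rightarrow> real) \<Rightarrow> (nat \<Rightarrow> real)" where
  "mat_apply n U x = (\<lambda>i\<in>{..<n}. \<Sum>j<n. U i j * x j)"

definition rotation_invariant_prob :: "nat \<Rightarrow> (nat \<Rightarrow> real) measure \<Rightarrow> bool" where
  "rotation_invariant_prob n \<mu> \<longleftrightarrow>
     prob_space \<mu> \<and>
     space \<mu> = unit_sphere n \<and>
     sets \<mu> = sets (restrict_space (Pi\<^sub>M {..<n} (\<lambda>_. borel)) (unit_sphere n)) \<and>
     (\<forall>U. orthogonal_mat n U \<longrightarrow> distr \<mu> \<mu> (mat_apply n U) = \<mu>)"

text \<open>
  For \<open>n \<ge> 1\<close> exactly one measure is invariant under the orthogonal group, so the description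
  below denotes; for \<open>n \<ge> 2\<close> invariance under the proper rotations alone singles out the same
  measure.
\<close>

definition sphere_measure :: "nat \<Rightarrow> (nat \<Rightarrow> real) measure" where
  "sphere_measure n = (THE \<mu>. rotation_invariant_prob n \<mu>)"

text \<open>\<open>M_neg_cube n p\<close> is \<open>M\<close> with index \<open>-p\<close> of the cube \<open>[-1,1]\<^sup>n\<close>, whose gauge is the
  maximum norm.\<close>

definition M_neg_cube :: "nat \<Rightarrow> real \<Rightarrow> real" where
  "M_neg_cube n p =
     (\<integral>\<theta>. sup_norm n \<theta> powr (- p) \<partial>sphere_measure n) powr (- 1 / p)"

end

(*
  The invariant probability measure on the sphere is the law of g/|g| for a standard Gaussian
  vector g. It is unique because any two invariant measures give equal mass to all caps of equal
  radius, and a differentiation argument then compares them on open sets.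

  Write L = ln (e + n/(1+p)). For p >= 1 the moment of order -p of the maximum norm X on the sphere
  is governed by the event X <= K sqrt (L/n). As |g| is of order sqrt n outside an event of
  probability at most exp (-n/2), respectively exp (-2n), the probability of that event is
  essentially P(|g_1| <= K sqrt L)^n, which for small K is at most (C/L)^(p/2) and for large K is
  at least exp (-4p). For p < 1 Jensen's inequality reduces the lower bound to the case p = 1, up
  to a constant factor in L, and the upper bound to an estimate of the mean of X.
*)

theory Submission
  imports Defs
begin

subsection \<open>Orthogonal matrices\<close>

text \<open>The sphere measure is given by a definite description, so nothing about it can be
  computed before existence and uniqueness are both known.

  In the moment estimates the trivial bound \<open>X \<ge> 1 / sqrt n\<close> on the sphere lets an
  exceptional event contribute at most n^(p/2) times its probability. A probability of order
  (C/L)^(p/2) is therefore exactly what can be afforded, and the norm error exp (-n/2) fits because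
  p ln L <= p (L - 1) <= n. The quantity 1 + p enters through n exp (-L) <= 1 + p: a box with side
  of order sqrt L then has probability no smaller than exp (-C (1 + p)), and this is harmless after
  taking a root of order p.

  The same root is the obstacle for p < 1: any constant factor in front of a moment becomes
  unbounded as p tends to 0, whereas for p >= 1 it disappears into a p-th power. Below 1 the moments
  are therefore compared through tangent lines, which carry a bound on a single mean over to all p
  without losing a factor.\<close>

definition sq_norm :: "nat \<Rightarrow> (nat \<Rightarrow> real) \<Rightarrow> real" where
  "sq_norm n x = (\<Sum>i<n. (x i)\<^sup>2)"

lemma sum_delta_ivl:
  fixes f :: "nat \<Rightarrow> real"
  assumes "i < n"
  shows "(\<Sum>j<n. (if i = j then 1 else 0) * f j) = f i" "(\<Sum>j<n. f j * (if i = j then 1 else 0)) = f i"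
    "(\<Sum>j<n. (if j = i then 1 else 0) * f j) = f i" "(\<Sum>j<n. f j * (if j = i then 1 else 0)) = f i"
  using assms by (simp_all add: if_distrib if_distribR cong: if_cong)

lemma sum_rotate:
  fixes f :: "'a \<Rightarrow> 'b \<Rightarrow> 'c \<Rightarrow> real"
  shows "(\<Sum>i\<in>A. \<Sum>j\<in>B. \<Sum>k\<in>C. f i j k) = (\<Sum>j\<in>B. \<Sum>k\<in>C. \<Sum>i\<in>A. f i j k)"
proof -
  have "(\<Sum>i\<in>A. \<Sum>j\<in>B. \<Sum>k\<in>C. f i j k) = (\<Sum>j\<in>B. \<Sum>i\<in>A. \<Sum>k\<in>C. f i j k)"
    by (rule sum.swap)
  also have "\<dots> = (\<Sum>j\<in>B. \<Sum>k\<in>C. \<Sum>i\<in>A. f i j k)"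
    by (intro sum.cong refl sum.swap)
  finally show ?thesis .
qed

text \<open>A left inverse of a square matrix is a right inverse; for a transpose this follows from
  \<open>\<parallel>I - U U\<^sup>T\<parallel>\<^sup>2 = n - 2 tr (U U\<^sup>T) + tr (U U\<^sup>T U U\<^sup>T) = 0\<close> in the Frobenius norm.\<close>

lemma orthogonal_mat_rows:
  assumes U: "orthogonal_mat n U" and "i < n" "j < n"
  shows "(\<Sum>k<n. U i k * U j k) = (if i = j then 1 else 0)"
proof -
  define P where "P i j = (\<Sum>k<n. U i k * U j k)" for i j
  define d :: "nat \<Rightarrow> nat \<Rightarrow> real" where "d i j = (if i = j then 1 else 0)" for i j
  have col: "(\<Sum>k<n. U k i * U k j) = d i j" if "i < n" "j < n" for i j
    using U that by (simp add: orthogonal_mat_def d_def)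
  have tr: "(\<Sum>i<n. P i i) = n"
  proof -
    have "(\<Sum>i<n. P i i) = (\<Sum>k<n. \<Sum>i<n. U i k * U i k)"
      unfolding P_def by (rule sum.swap)
    also have "\<dots> = (\<Sum>k<n. 1)" by (intro sum.cong) (auto simp: col d_def)
    finally show ?thesis by simp
  qed
  have sq: "(\<Sum>i<n. \<Sum>j<n. (P i j)\<^sup>2) = n"
  proof -
    have "(\<Sum>i<n. \<Sum>j<n. (P i j)\<^sup>2) = (\<Sum>i<n. \<Sum>j<n. \<Sum>k<n. \<Sum>l<n. (U i k * U i l) * (U j k * U j l))"
      unfolding P_def power2_eq_square sum_product by (simp add: mult_ac)
    also have "\<dots> = (\<Sum>i<n. \<Sum>k<n. \<Sum>l<n. \<Sum>j<n. (U i k * U i l) * (U j k * U j l))"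
      by (intro sum.cong refl sum_rotate)
    also have "\<dots> = (\<Sum>i<n. \<Sum>k<n. \<Sum>l<n. (U i k * U i l) * d k l)"
      by (intro sum.cong refl) (auto simp: sum_distrib_left[symmetric] col)
    also have "\<dots> = (\<Sum>i<n. \<Sum>k<n. U i k * U i k)"
      by (intro sum.cong refl) (auto simp: d_def sum_delta_ivl)
    finally show ?thesis using tr by (simp add: P_def)
  qed
  have "(\<Sum>i<n. \<Sum>j<n. (P i j - d i j)\<^sup>2) = (\<Sum>i<n. \<Sum>j<n. (P i j)\<^sup>2 + d i j - 2 * (P i j * d i j))"
    by (intro sum.cong) (auto simp: d_def power2_eq_square algebra_simps)
  also have "\<dots> = (\<Sum>i<n. \<Sum>j<n. (P i j)\<^sup>2) + (\<Sum>i<n. \<Sum>j<n. d i j) - 2 * (\<Sum>i<n. \<Sum>j<n. P i j * d i j)"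
    by (simp add: sum.distrib sum_subtractf sum_distrib_left)
  also have "(\<Sum>i<n. \<Sum>j<n. P i j * d i j) = (\<Sum>i<n. P i i)"
    by (intro sum.cong refl) (auto simp: d_def sum_delta_ivl)
  also have "(\<Sum>i<n. \<Sum>j<n. d i j) = n"
    by (simp add: d_def)
  finally have "(\<Sum>i<n. \<Sum>j<n. (P i j - d i j)\<^sup>2) = 0"
    using tr sq by simp
  then have "(P i j - d i j)\<^sup>2 = 0"
    using assms(2,3) by (simp add: sum_nonneg_eq_0_iff sum_nonneg)
  then show ?thesis by (simp add: P_def d_def)
qed

lemma mat_apply_sq_norm:
  assumes U: "orthogonal_mat n U"
  shows "sq_norm n (mat_apply n U x) = sq_norm n x"
proof -
  have "sq_norm n (mat_apply n U x) = (\<Sum>i<n. \<Sum>j<n. \<Sum>k<n. (U i j * U i k) * (x j * x k))"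
    by (simp add: sq_norm_def mat_apply_def power2_eq_square sum_product mult_ac)
  also have "\<dots> = (\<Sum>j<n. \<Sum>k<n. \<Sum>i<n. (U i j * U i k) * (x j * x k))"
    by (rule sum_rotate)
  also have "\<dots> = (\<Sum>j<n. \<Sum>k<n. (if j = k then 1 else 0) * (x j * x k))"
    using U by (intro sum.cong refl) (auto simp: sum_distrib_right[symmetric] orthogonal_mat_def)
  also have "\<dots> = (\<Sum>j<n. x j * x j)"
    by (intro sum.cong refl) (auto simp: sum_delta_ivl)
  finally show ?thesis by (simp add: sq_norm_def power2_eq_square)
qed

lemma mat_apply_transpose:
  assumes U: "orthogonal_mat n U" and x: "x \<in> extensional {..<n}"
  shows "mat_apply n U (mat_apply n (\<lambda>i j. U j i) x) = x"
proof
  fix i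
  show "mat_apply n U (mat_apply n (\<lambda>i j. U j i) x) i = x i"
  proof (cases "i < n")
    case True
    then have "mat_apply n U (mat_apply n (\<lambda>i j. U j i) x) i = (\<Sum>j<n. \<Sum>k<n. (U i j * U k j) * x k)"
      by (simp add: mat_apply_def sum_distrib_left mult_ac)
    also have "\<dots> = (\<Sum>k<n. \<Sum>j<n. (U i j * U k j) * x k)" by (rule sum.swap)
    also have "\<dots> = (\<Sum>k<n. (if i = k then 1 else 0) * x k)"
      using True by (intro sum.cong refl) (auto simp: sum_distrib_right[symmetric] orthogonal_mat_rows[OF U])
    also have "\<dots> = x i" using True by (rule sum_delta_ivl)
    finally show ?thesis .
  qed (use x in \<open>auto simp: mat_apply_def extensional_def\<close>)
qed

lemma sq_norm_nonneg: "0 \<le> sq_norm n x"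
  by (simp add: sq_norm_def sum_nonneg)

lemma unit_sphere_iff: "x \<in> unit_sphere n \<longleftrightarrow> x \<in> extensional {..<n} \<and> sq_norm n x = 1"
  by (auto simp: unit_sphere_def sq_norm_def PiE_def)

lemma mat_apply_sphere:
  assumes "orthogonal_mat n U" "x \<in> unit_sphere n"
  shows "mat_apply n U x \<in> unit_sphere n"
  using assms mat_apply_sq_norm[OF assms(1), of x] by (simp add: unit_sphere_iff) (simp add: mat_apply_def)

lemma mat_apply_diff:
  "sq_norm n (\<lambda>i. mat_apply n U x i - mat_apply n U y i) = sq_norm n (mat_apply n U (\<lambda>i. x i - y i))"
  by (simp add: mat_apply_def sq_norm_def sum_subtractf right_diff_distrib)

text \<open>The reflection exchanging \<open>x\<close> and \<open>y\<close>.\<close>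

lemma orthogonal_transitive:
  assumes x: "x \<in> unit_sphere n" and y: "y \<in> unit_sphere n"
  obtains U where "orthogonal_mat n U" "mat_apply n U x = y"
proof (cases "x = y")
  case True
  have "orthogonal_mat n (\<lambda>i j. if i = j then 1 else 0)"
    by (simp add: orthogonal_mat_def sum_delta_ivl)
  moreover have "mat_apply n (\<lambda>i j. if i = j then 1 else 0) x = y"
    using x True by (auto simp: mat_apply_def fun_eq_iff sum_delta_ivl unit_sphere_iff extensional_def)
  ultimately show ?thesis using that by blast
next
  case False
  define v where "v i = x i - y i" for i
  define s where "s = (\<Sum>i<n. v i * v i)"
  define t where "t = (\<Sum>i<n. v i * x i)"
  have "s \<noteq> 0"
  proof
    assume "s = 0"
    then have "\<forall>i<n. v i = 0" by (auto simp: s_def sum_nonneg_eq_0_iff)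
    with x y have "x = y" by (intro extensionalityI[of _ "{..<n}"]) (auto simp: unit_sphere_iff v_def)
    with False show False ..
  qed
  have xx: "(\<Sum>i<n. x i * x i) = 1" "(\<Sum>i<n. y i * y i) = 1"
    using x y by (auto simp: unit_sphere_iff sq_norm_def power2_eq_square)
  \<comment> \<open>Since \<open>x\<close> and \<open>y\<close> have equal norm,
    \<open>v = x - y\<close> satisfies |v|^2 = 2 <v, x>. Hence \<open>c * t = 1\<close>, and
    subtracting \<open>c * t\<close> times \<open>v\<close> from \<open>x\<close> lands exactly on
    \<open>y\<close>.\<close>
  have s2t: "s = 2 * t"
  proof -
    have "s = (\<Sum>i<n. x i * x i) + (\<Sum>i<n. y i * y i) - 2 * (\<Sum>i<n. x i * y i)"
      by (simp add: s_def v_def algebra_simps sum.distrib sum_subtractf sum_distrib_left)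
    moreover have "t = (\<Sum>i<n. x i * x i) - (\<Sum>i<n. x i * y i)"
      by (simp add: t_def v_def algebra_simps sum_subtractf)
    ultimately show ?thesis using xx by simp
  qed
  define d :: "nat \<Rightarrow> nat \<Rightarrow> real" where "d i j = (if i = j then 1 else 0)" for i j
  define c where "c = 2 / s"
  have cs: "c * s = 2" "c * t = 1" using \<open>s \<noteq> 0\<close> s2t by (auto simp: c_def)
  define U where "U i j = d i j - c * (v i * v j)" for i j
  have "orthogonal_mat n U"
    unfolding orthogonal_mat_def
  proof safe
    fix i j assume ij: "i < n" "j < n"
    have "(\<Sum>k<n. U k i * U k j) = (\<Sum>k<n. d k i * d k j - c * (d k i * (v k * v j)) - c * (d k j * (v k * v i)) + c * c * (v i * v j) * (v k * v k))"
      by (intro sum.cong refl) (simp add: U_def algebra_simps)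
    also have "\<dots> = (\<Sum>k<n. d k i * d k j) - c * (\<Sum>k<n. d k i * (v k * v j)) - c * (\<Sum>k<n. d k j * (v k * v i)) + c * c * (v i * v j) * s"
      unfolding s_def sum_distrib_left sum.distrib sum_subtractf ..
    also have "\<dots> = d i j - c * (v i * v j) - c * (v j * v i) + c * (c * s) * (v i * v j)"
      using ij by (simp add: d_def sum_delta_ivl)
    also have "\<dots> = d i j" unfolding cs by simp
    finally show "(\<Sum>k<n. U k i * U k j) = (if i = j then 1 else 0)" by (simp add: d_def)
  qed
  moreover have "mat_apply n U x = y"
  proof
    fix i
    show "mat_apply n U x i = y i"
    proof (cases "i < n")
      case True
      then have "mat_apply n U x i = (\<Sum>j<n. d i j * x j - c * v i * (v j * x j))"
        by (simp add: mat_apply_def U_def algebra_simps)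
      also have "\<dots> = (\<Sum>j<n. d i j * x j) - v i * (c * t)"
        by (simp add: sum_subtractf sum_distrib_left t_def mult_ac)
      also have "\<dots> = x i - v i"
        unfolding cs using True by (simp add: d_def sum_delta_ivl)
      finally show ?thesis by (simp add: v_def)
    qed (use y in \<open>auto simp: mat_apply_def unit_sphere_iff extensional_def\<close>)
  qed
  ultimately show ?thesis using that by blast
qed

subsection \<open>Rotation invariance of Lebesgue and Gaussian measure\<close>

definition lebesgue_n :: "nat \<Rightarrow> (nat \<Rightarrow> real) measure" where
  "lebesgue_n n = Pi\<^sub>M {..<n} (\<lambda>_. lborel)"

definition gauss_n :: "nat \<Rightarrow> (nat \<Rightarrow> real) measure" where
  "gauss_n n = Pi\<^sub>M {..<n} (\<lambda>_. density lborel std_normal_density)"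

definition gauss_density :: "nat \<Rightarrow> (nat \<Rightarrow> real) \<Rightarrow> real" where
  "gauss_density n x = (1 / sqrt (2 * pi)) ^ n * exp (- sq_norm n x / 2)"

lemma sets_lebesgue_n [measurable_cong]: "sets (lebesgue_n n) = sets (Pi\<^sub>M {..<n} (\<lambda>_. borel))"
  unfolding lebesgue_n_def by (intro sets_PiM_cong) auto

lemma sets_gauss_n [measurable_cong]: "sets (gauss_n n) = sets (Pi\<^sub>M {..<n} (\<lambda>_. borel))"
  unfolding gauss_n_def by (intro sets_PiM_cong) auto

lemma space_lebesgue_n: "space (lebesgue_n n) = {..<n} \<rightarrow>\<^sub>E UNIV"
  by (simp add: lebesgue_n_def space_PiM)

lemma space_gauss_n: "space (gauss_n n) = {..<n} \<rightarrow>\<^sub>E UNIV"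
  by (simp add: gauss_n_def space_PiM)

lemma measurable_sq_norm [measurable]: "sq_norm n \<in> borel_measurable (Pi\<^sub>M {..<n} (\<lambda>_. borel))"
  unfolding sq_norm_def[abs_def] by measurable

lemma measurable_mat_apply [measurable]:
  "mat_apply n U \<in> Pi\<^sub>M {..<n} (\<lambda>_. borel) \<rightarrow>\<^sub>M Pi\<^sub>M {..<n} (\<lambda>_. borel)"
  unfolding mat_apply_def[abs_def] by measurable

lemma measurable_gauss_density [measurable]:
  "gauss_density n \<in> borel_measurable (Pi\<^sub>M {..<n} (\<lambda>_. borel))"
  unfolding gauss_density_def[abs_def] by measurable

lemma gauss_density_eq_prod: "gauss_density n x = (\<Prod>i<n. std_normal_density (x i))"
proof -
  have "(\<Prod>i<n. std_normal_density (x i)) = (1 / sqrt (2 * pi)) ^ n * (\<Prod>i<n. exp (- (x i)\<^sup>2 / 2))"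
    unfolding std_normal_density_def prod.distrib by simp
  also have "(\<Prod>i<n. exp (- (x i)\<^sup>2 / 2)) = exp (- sq_norm n x / 2)"
    by (simp add: exp_sum[symmetric] sq_norm_def sum_negf sum_divide_distrib)
  finally show ?thesis by (simp add: gauss_density_def)
qed

text \<open>The product form gives independent coordinates, the density form shows that only the
  norm matters. The two are compared on boxes, where the integral of a product factorizes.\<close>

lemma gauss_n_eq_density: "gauss_n n = density (lebesgue_n n) (\<lambda>x. ennreal (gauss_density n x))"
proof -
  interpret G: product_sigma_finite "\<lambda>_::nat. density lborel (\<lambda>x. ennreal (std_normal_density x))"
    unfolding product_sigma_finite_def
    using prob_space_normal_density[of 1 0] by (auto intro: prob_space_imp_sigma_finite)
  interpret L: product_sigma_finite "\<lambda>_::nat. lborel :: real measure" ..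
  have "density (lebesgue_n n) (\<lambda>x. ennreal (gauss_density n x)) = Pi\<^sub>M {..<n} (\<lambda>_. density lborel (\<lambda>x. ennreal (std_normal_density x)))"
  proof (rule G.PiM_eqI)
    show "sets (density (lebesgue_n n) (\<lambda>x. ennreal (gauss_density n x))) =
      sets (Pi\<^sub>M {..<n} (\<lambda>_. density lborel (\<lambda>x. ennreal (std_normal_density x))))"
      using sets_lebesgue_n sets_gauss_n[unfolded gauss_n_def] by simp
    fix A :: "nat \<Rightarrow> real set"
    assume A: "\<And>i. i \<in> {..<n} \<Longrightarrow> A i \<in> sets (density lborel (\<lambda>x. ennreal (std_normal_density x)))"
    then have A'[measurable]: "i < n \<Longrightarrow> A i \<in> sets borel" for i by auto
    have [measurable]: "Pi\<^sub>E {..<n} A \<in> sets (Pi\<^sub>M {..<n} (\<lambda>_. borel))"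
      using A' by (intro sets_PiM_I_finite) auto
    have "emeasure (density (lebesgue_n n) (\<lambda>x. ennreal (gauss_density n x))) (Pi\<^sub>E {..<n} A) =
      (\<integral>\<^sup>+x. ennreal (gauss_density n x) * indicator (Pi\<^sub>E {..<n} A) x \<partial>lebesgue_n n)"
      by (rule emeasure_density) measurable
    also have "\<dots> = (\<integral>\<^sup>+x. (\<Prod>i<n. ennreal (std_normal_density (x i)) * indicator (A i) (x i)) \<partial>lebesgue_n n)"
    proof (intro nn_integral_cong)
      fix x assume "x \<in> space (lebesgue_n n)"
      then have "indicator (Pi\<^sub>E {..<n} A) x = (\<Prod>i<n. indicator (A i) (x i) :: ennreal)"
        by (auto simp: indicator_def space_lebesgue_n PiE_iff)
      then show "ennreal (gauss_density n x) * indicator (Pi\<^sub>E {..<n} A) x =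
         (\<Prod>i<n. ennreal (std_normal_density (x i)) * indicator (A i) (x i))"
        by (simp add: gauss_density_eq_prod prod.distrib prod_ennreal)
    qed
    also have "\<dots> = (\<Prod>i<n. \<integral>\<^sup>+x. ennreal (std_normal_density x) * indicator (A i) x \<partial>lborel)"
      unfolding lebesgue_n_def by (rule L.product_nn_integral_prod) auto
    also have "\<dots> = (\<Prod>i<n. emeasure (density lborel (\<lambda>x. ennreal (std_normal_density x))) (A i))"
      by (intro prod.cong refl) (auto simp: emeasure_density)
    finally show "emeasure (density (lebesgue_n n) (\<lambda>x. ennreal (gauss_density n x))) (Pi\<^sub>E {..<n} A) =
       (\<Prod>i<n. emeasure (density lborel (\<lambda>x. ennreal (std_normal_density x))) (A i))" .
  qed simp
  then show ?thesis by (simp add: gauss_n_def)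
qed

lemma prob_space_gauss_n: "prob_space (gauss_n n)"
  unfolding gauss_n_def by (intro prob_space_PiM prob_space_normal_density) simp

lemma sigma_finite_lebesgue_n: "sigma_finite_measure (lebesgue_n n)"
proof -
  interpret L: product_sigma_finite "\<lambda>_::nat. lborel :: real measure" ..
  show ?thesis unfolding lebesgue_n_def by (rule L.sigma_finite) simp
qed

lemma nn_integral_gauss_density: "(\<integral>\<^sup>+x. ennreal (gauss_density n x) \<partial>lebesgue_n n) = 1"
proof -
  have "(\<integral>\<^sup>+x. ennreal (gauss_density n x) \<partial>lebesgue_n n) = emeasure (gauss_n n) (space (gauss_n n))"
    unfolding gauss_n_eq_density by (subst emeasure_density) (auto intro!: nn_integral_cong)
  then show ?thesis using prob_space.emeasure_space_1[OF prob_space_gauss_n] by simp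
qed

text \<open>On boxes this reduces to translation invariance on the line. It is the only symmetry of
  Lebesgue measure from which rotation invariance is derived.\<close>

lemma lebesgue_n_translate:
  "distr (lebesgue_n n) (Pi\<^sub>M {..<n} (\<lambda>_. borel)) (\<lambda>x. \<lambda>i\<in>{..<n}. x i + z i) = lebesgue_n n"
proof -
  interpret L: product_sigma_finite "\<lambda>_::nat. lborel :: real measure" ..
  have [measurable]: "(\<lambda>x. \<lambda>i\<in>{..<n}. x i + z i) \<in> Pi\<^sub>M {..<n} (\<lambda>_. borel) \<rightarrow>\<^sub>M Pi\<^sub>M {..<n} (\<lambda>_. borel)"
    by measurable
  show ?thesis
    unfolding lebesgue_n_def
  proof (rule L.PiM_eqI)
    show "sets (distr (Pi\<^sub>M {..<n} (\<lambda>_. lborel)) (Pi\<^sub>M {..<n} (\<lambda>_. borel)) (\<lambda>x. \<lambda>i\<in>{..<n}. x i + z i)) =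
      sets (Pi\<^sub>M {..<n} (\<lambda>_. lborel :: real measure))"
      using sets_lebesgue_n[of n] by (simp add: lebesgue_n_def)
    fix A :: "nat \<Rightarrow> real set"
    assume A: "\<And>i. i \<in> {..<n} \<Longrightarrow> A i \<in> sets lborel"
    then have A'[measurable]: "i < n \<Longrightarrow> A i \<in> sets borel" for i by auto
    have [measurable]: "Pi\<^sub>E {..<n} A \<in> sets (Pi\<^sub>M {..<n} (\<lambda>_. borel))"
      using A' by (intro sets_PiM_I_finite) auto
    have "emeasure (distr (lebesgue_n n) (Pi\<^sub>M {..<n} (\<lambda>_. borel)) (\<lambda>x. \<lambda>i\<in>{..<n}. x i + z i)) (Pi\<^sub>E {..<n} A)
      = emeasure (lebesgue_n n) ((\<lambda>x. \<lambda>i\<in>{..<n}. x i + z i) -` (Pi\<^sub>E {..<n} A) \<inter> space (lebesgue_n n))"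
      by (rule emeasure_distr) measurable
    also have "(\<lambda>x. \<lambda>i\<in>{..<n}. x i + z i) -` (Pi\<^sub>E {..<n} A) \<inter> space (lebesgue_n n) =
      Pi\<^sub>E {..<n} (\<lambda>i. (\<lambda>t. t + z i) -` A i)"
      by (auto simp: space_lebesgue_n PiE_iff)
    also have "emeasure (lebesgue_n n) \<dots> = (\<Prod>i<n. emeasure lborel ((\<lambda>t. t + z i) -` A i))"
      unfolding lebesgue_n_def
    proof (rule L.emeasure_PiM)
      fix i assume "i \<in> {..<n}"
      then show "(\<lambda>t. t + z i) -` A i \<in> sets lborel"
        using measurable_sets[of "\<lambda>t. t + z i" borel borel "A i"] A' by simp
    qed simp
    also have "\<dots> = (\<Prod>i<n. emeasure lborel (A i))"
    proof (intro prod.cong refl)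
      fix i assume i: "i \<in> {..<n}"
      have plus_z: "(+) (z i) = (\<lambda>t. t + z i)" by (simp add: fun_eq_iff add.commute)
      have "emeasure lborel (A i) = emeasure (distr lborel borel ((+) (z i))) (A i)"
        by (simp add: lborel_distr_plus)
      also have "\<dots> = emeasure lborel ((\<lambda>t. t + z i) -` A i)"
        using i by (subst emeasure_distr) (auto simp: plus_z)
      finally show "emeasure lborel ((\<lambda>t. t + z i) -` A i) = emeasure lborel (A i)" ..
    qed
    finally show "emeasure (distr (Pi\<^sub>M {..<n} (\<lambda>_. lborel)) (Pi\<^sub>M {..<n} (\<lambda>_. borel)) (\<lambda>x. \<lambda>i\<in>{..<n}. x i + z i)) (Pi\<^sub>E {..<n} A) =
         (\<Prod>i<n. emeasure lborel (A i))"
      unfolding lebesgue_n_def .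
  qed simp
qed

lemma nn_integral_lebesgue_n_translate:
  assumes [measurable]: "f \<in> borel_measurable (Pi\<^sub>M {..<n} (\<lambda>_. borel))"
  shows "(\<integral>\<^sup>+x. f (\<lambda>i\<in>{..<n}. x i + z i) \<partial>lebesgue_n n) = (\<integral>\<^sup>+x. f x \<partial>lebesgue_n n)"
proof -
  have "(\<integral>\<^sup>+x. f x \<partial>distr (lebesgue_n n) (Pi\<^sub>M {..<n} (\<lambda>_. borel)) (\<lambda>x. \<lambda>i\<in>{..<n}. x i + z i)) =
    (\<integral>\<^sup>+x. f (\<lambda>i\<in>{..<n}. x i + z i) \<partial>lebesgue_n n)"
    by (rule nn_integral_distr) measurable
  then show ?thesis unfolding lebesgue_n_translate ..
qed

text \<open>The argument for uniqueness of translation-invariant measures: integrate against the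
  Gaussian density \<open>g\<close>, which is invariant under \<open>U\<close>, and translate both variables in
  \<open>\<integral>\<integral> g(x) f(U y) dy dx\<close>.\<close>

lemma nn_integral_lebesgue_n_rotate:
  assumes U: "orthogonal_mat n U" and f[measurable]: "f \<in> borel_measurable (Pi\<^sub>M {..<n} (\<lambda>_. borel))"
  shows "(\<integral>\<^sup>+x. f (mat_apply n U x) \<partial>lebesgue_n n) = (\<integral>\<^sup>+x. f x \<partial>lebesgue_n n)"
proof -
  let ?L = "lebesgue_n n" and ?g = "\<lambda>x. ennreal (gauss_density n x)"
  let ?T = "mat_apply n (\<lambda>i j. U j i)"
  let ?a = "\<lambda>x y. \<lambda>i\<in>{..<n}. x i + y i :: real" and ?s = "\<lambda>x y. \<lambda>i\<in>{..<n}. x i - y i :: real"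
  interpret sigma_finite_measure ?L by (rule sigma_finite_lebesgue_n)
  interpret P: pair_sigma_finite ?L ?L ..
  have Uadd: "mat_apply n U (?a y (?T x)) = ?a (mat_apply n U y) x" if "x \<in> space ?L" for x y
  proof -
    have "mat_apply n U (?a y (?T x)) = ?a (mat_apply n U y) (mat_apply n U (?T x))"
      by (auto simp: mat_apply_def fun_eq_iff distrib_left sum.distrib)
    also have "mat_apply n U (?T x) = x"
      using that by (intro mat_apply_transpose U) (auto simp: space_lebesgue_n PiE_def)
    finally show ?thesis .
  qed
  have gU: "gauss_density n (?s x (mat_apply n U y)) = gauss_density n (?a y (\<lambda>i. - ?T x i))" if "x \<in> space ?L" for x y
  proof -
    have "mat_apply n U (?a y (\<lambda>i. - ?T x i)) = (\<lambda>i\<in>{..<n}. mat_apply n U y i - mat_apply n U (?T x) i)"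
      by (auto simp: mat_apply_def fun_eq_iff right_diff_distrib sum_subtractf)
    also have "mat_apply n U (?T x) = x"
      using that by (intro mat_apply_transpose U) (auto simp: space_lebesgue_n PiE_def)
    finally have "sq_norm n (mat_apply n U (?a y (\<lambda>i. - ?T x i))) = sq_norm n (\<lambda>i\<in>{..<n}. mat_apply n U y i - x i)"
      by (rule arg_cong)
    then have "sq_norm n (?a y (\<lambda>i. - ?T x i)) = sq_norm n (\<lambda>i\<in>{..<n}. mat_apply n U y i - x i)"
      unfolding mat_apply_sq_norm[OF U] .
    then show ?thesis
      by (simp add: gauss_density_def sq_norm_def power2_commute)
  qed
  have "(\<integral>\<^sup>+y. f (mat_apply n U y) \<partial>?L) = (\<integral>\<^sup>+x. ?g x * (\<integral>\<^sup>+y. f (mat_apply n U y) \<partial>?L) \<partial>?L)"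
    by (simp add: nn_integral_multc nn_integral_gauss_density)
  \<comment> \<open>Shifting \<open>y\<close> by \<open>?T x\<close> turns \<open>U y\<close> into
    \<open>U y + x\<close>, because \<open>U\<close> undoes its transpose.\<close>
  also have "\<dots> = (\<integral>\<^sup>+x. ?g x * (\<integral>\<^sup>+y. f (mat_apply n U (?a y (?T x))) \<partial>?L) \<partial>?L)"
    by (subst nn_integral_lebesgue_n_translate[where f="\<lambda>y. f (mat_apply n U y)"]) auto
  also have "\<dots> = (\<integral>\<^sup>+x. (\<integral>\<^sup>+y. ?g x * f (?a (mat_apply n U y) x) \<partial>?L) \<partial>?L)"
    by (intro nn_integral_cong) (simp add: Uadd nn_integral_cmult)
  also have "\<dots> = (\<integral>\<^sup>+y. (\<integral>\<^sup>+x. ?g x * f (?a (mat_apply n U y) x) \<partial>?L) \<partial>?L)"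
    by (rule P.Fubini') measurable
  \<comment> \<open>For fixed \<open>y\<close>, shifting \<open>x\<close> by \<open>- U y\<close>
    moves the dependence on \<open>y\<close> out of \<open>f\<close> and into the Gaussian
    factor.\<close>
  also have "\<dots> = (\<integral>\<^sup>+y. (\<integral>\<^sup>+x. ?g (?s x (mat_apply n U y)) * f x \<partial>?L) \<partial>?L)"
  proof (rule nn_integral_cong)
    fix y assume "y \<in> space ?L"
    have *: "(\<integral>\<^sup>+x. ?g (?s x w) * f x \<partial>?L) = (\<integral>\<^sup>+x. ?g x * f (?a w x) \<partial>?L)" for w
    proof -
      have "(\<integral>\<^sup>+x. ?g (?s x w) * f x \<partial>?L) = (\<integral>\<^sup>+x. ?g (?s (\<lambda>i\<in>{..<n}. x i + w i) w) * f (\<lambda>i\<in>{..<n}. x i + w i) \<partial>?L)"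
        by (subst nn_integral_lebesgue_n_translate[where f="\<lambda>x. ?g (?s x w) * f x"]) auto
      also have "\<dots> = (\<integral>\<^sup>+x. ?g x * f (?a w x) \<partial>?L)"
        by (intro nn_integral_cong) (simp add: gauss_density_def sq_norm_def add.commute cong: restrict_cong)
      finally show ?thesis .
    qed
    show "(\<integral>\<^sup>+x. ?g x * f (?a (mat_apply n U y) x) \<partial>?L) = (\<integral>\<^sup>+x. ?g (?s x (mat_apply n U y)) * f x \<partial>?L)"
      by (rule *[symmetric])
  qed
  also have "\<dots> = (\<integral>\<^sup>+x. (\<integral>\<^sup>+y. ?g (?s x (mat_apply n U y)) * f x \<partial>?L) \<partial>?L)"
  proof (rule P.Fubini'[where f="\<lambda>x y. ?g (?s x (mat_apply n U y)) * f x"])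
    have "(\<lambda>p. \<lambda>i\<in>{..<n}. fst p i - mat_apply n U (snd p) i) \<in> ?L \<Otimes>\<^sub>M ?L \<rightarrow>\<^sub>M Pi\<^sub>M {..<n} (\<lambda>_. borel)"
    proof (rule measurable_restrict)
      fix i assume i: "i \<in> {..<n}"
      then have "(\<lambda>p. fst p i - (\<Sum>j<n. U i j * snd p j)) \<in> borel_measurable (?L \<Otimes>\<^sub>M ?L)"
        by measurable
      then show "(\<lambda>p. fst p i - mat_apply n U (snd p) i) \<in> borel_measurable (?L \<Otimes>\<^sub>M ?L)"
        using i by (simp add: mat_apply_def)
    qed
    from measurable_compose[OF this measurable_gauss_density]
    have [measurable]: "(\<lambda>p. gauss_density n (?s (fst p) (mat_apply n U (snd p)))) \<in> borel_measurable (?L \<Otimes>\<^sub>M ?L)" .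
    show "(\<lambda>(x, y). ?g (?s x (mat_apply n U y)) * f x) \<in> borel_measurable (?L \<Otimes>\<^sub>M ?L)"
      unfolding case_prod_beta' by measurable
  qed
  \<comment> \<open>Here |x - U y| = |y - ?T x|, so the inner integral is that of a translated
    Gaussian density and equals 1.\<close>
  also have "\<dots> = (\<integral>\<^sup>+x. (\<integral>\<^sup>+y. ?g (?a y (\<lambda>i. - ?T x i)) \<partial>?L) * f x \<partial>?L)"
    by (intro nn_integral_cong) (simp add: gU nn_integral_multc)
  also have "\<dots> = (\<integral>\<^sup>+x. f x \<partial>?L)"
    by (subst nn_integral_lebesgue_n_translate) (auto simp: nn_integral_gauss_density)
  finally show ?thesis .
qed

lemma gauss_n_rotate:
  assumes U: "orthogonal_mat n U"
  shows "distr (gauss_n n) (gauss_n n) (mat_apply n U) = gauss_n n"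
proof (rule measure_eqI)
  fix A assume "A \<in> sets (distr (gauss_n n) (gauss_n n) (mat_apply n U))"
  then have A[measurable]: "A \<in> sets (Pi\<^sub>M {..<n} (\<lambda>_. borel))" by (simp add: sets_gauss_n)
  have "emeasure (distr (gauss_n n) (gauss_n n) (mat_apply n U)) A = (\<integral>\<^sup>+x. indicator A x \<partial>distr (gauss_n n) (gauss_n n) (mat_apply n U))"
    by simp
  also have "\<dots> = (\<integral>\<^sup>+x. indicator A (mat_apply n U x) \<partial>gauss_n n)"
    by (rule nn_integral_distr) measurable
  also have "\<dots> = (\<integral>\<^sup>+x. ennreal (gauss_density n (mat_apply n U x)) * indicator A (mat_apply n U x) \<partial>lebesgue_n n)"
    unfolding gauss_n_eq_density
    by (subst nn_integral_density) (auto simp: gauss_density_def mat_apply_sq_norm[OF U])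
  also have "\<dots> = (\<integral>\<^sup>+x. ennreal (gauss_density n x) * indicator A x \<partial>lebesgue_n n)"
    by (rule nn_integral_lebesgue_n_rotate[OF U]) measurable
  also have "\<dots> = emeasure (gauss_n n) A"
    unfolding gauss_n_eq_density by (subst emeasure_density) auto
  finally show "emeasure (distr (gauss_n n) (gauss_n n) (mat_apply n U)) A = emeasure (gauss_n n) A" .
qed simp

subsection \<open>Uniqueness of the rotation-invariant probability measure\<close>

text \<open>The parameter \<open>r\<close> bounds the squared distance, which avoids square roots at
  the price of a factor 2 in the triangle inequality. The centre may lie off the sphere; the
  covering by caps with rational centres relies on this.\<close>

definition cap :: "nat \<Rightarrow> (nat \<Rightarrow> real) \<Rightarrow> real \<Rightarrow> (nat \<Rightarrow> real) set" where
  "cap n x r = {y \<in> unit_sphere n. sq_norm n (\<lambda>i. x i - y i) < r}"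

lemma sets_unit_sphere [measurable]: "unit_sphere n \<in> sets (Pi\<^sub>M {..<n} (\<lambda>_. borel))"
proof -
  have "unit_sphere n = {x \<in> space (Pi\<^sub>M {..<n} (\<lambda>_. borel)). sq_norm n x = 1}"
    by (auto simp: unit_sphere_iff space_PiM PiE_def)
  also have "\<dots> \<in> sets (Pi\<^sub>M {..<n} (\<lambda>_. borel))" by measurable
  finally show ?thesis .
qed

lemma rotation_invariant_prob_sets:
  assumes "rotation_invariant_prob n \<mu>"
  shows "A \<in> sets \<mu> \<longleftrightarrow> A \<subseteq> unit_sphere n \<and> A \<in> sets (Pi\<^sub>M {..<n} (\<lambda>_. borel))"
  using assms unfolding rotation_invariant_prob_def
  by (auto simp: sets_restrict_space_iff)

lemma rotation_invariant_prob_measurable_id: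
  assumes "rotation_invariant_prob n \<mu>"
  shows "(\<lambda>x. x) \<in> \<mu> \<rightarrow>\<^sub>M Pi\<^sub>M {..<n} (\<lambda>_. borel)"
proof -
  have "(\<lambda>x. x) \<in> restrict_space (Pi\<^sub>M {..<n} (\<lambda>_. borel)) (unit_sphere n) \<rightarrow>\<^sub>M Pi\<^sub>M {..<n} (\<lambda>_. borel :: real measure)"
    by (intro measurable_restrict_space1) simp
  moreover have "sets \<mu> = sets (restrict_space (Pi\<^sub>M {..<n} (\<lambda>_. borel)) (unit_sphere n))"
    using assms by (simp add: rotation_invariant_prob_def)
  ultimately show ?thesis by (simp cong: measurable_cong_sets)
qed

lemma measurable_cap: "cap n x r \<in> sets (Pi\<^sub>M {..<n} (\<lambda>_. borel))"
proof -
  have "cap n x r = unit_sphere n \<inter> {y \<in> space (Pi\<^sub>M {..<n} (\<lambda>_. borel)). sq_norm n (\<lambda>i. x i - y i) < r}"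
    by (auto simp: cap_def unit_sphere_iff space_PiM PiE_def)
  also have "\<dots> \<in> sets (Pi\<^sub>M {..<n} (\<lambda>_. borel))" unfolding sq_norm_def by measurable
  finally show ?thesis .
qed

lemma rotation_invariant_prob_cap_sets:
  "rotation_invariant_prob n \<mu> \<Longrightarrow> cap n x r \<in> sets \<mu>"
  using measurable_cap[of n x r] by (simp add: rotation_invariant_prob_sets) (simp add: cap_def)

text \<open>The orthogonal maps act transitively on the sphere and preserve distances, so one of
  them pulls the cap about \<open>y\<close> back to the cap about \<open>x\<close>.\<close>

lemma emeasure_cap_const:
  assumes \<mu>: "rotation_invariant_prob n \<mu>" and "x \<in> unit_sphere n" "y \<in> unit_sphere n"
  shows "emeasure \<mu> (cap n x r) = emeasure \<mu> (cap n y r)"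
proof -
  obtain U where U: "orthogonal_mat n U" "mat_apply n U x = y"
    using orthogonal_transitive assms(2,3) by blast
  have sp: "space \<mu> = unit_sphere n" and inv: "distr \<mu> \<mu> (mat_apply n U) = \<mu>"
    using \<mu> U(1) by (auto simp: rotation_invariant_prob_def)
  have m: "mat_apply n U \<in> \<mu> \<rightarrow>\<^sub>M \<mu>"
  proof -
    have "mat_apply n U \<in> \<mu> \<rightarrow>\<^sub>M restrict_space (Pi\<^sub>M {..<n} (\<lambda>_. borel)) (unit_sphere n)"
      using measurable_compose[OF rotation_invariant_prob_measurable_id[OF \<mu>] measurable_mat_apply]
      by (intro measurable_restrict_space2) (auto simp: sp intro!: mat_apply_sphere U)
    then show ?thesis using \<mu> by (simp add: rotation_invariant_prob_def cong: measurable_cong_sets)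
  qed
  have "emeasure \<mu> (cap n y r) = emeasure (distr \<mu> \<mu> (mat_apply n U)) (cap n y r)"
    using inv by simp
  also have "\<dots> = emeasure \<mu> (mat_apply n U -` cap n y r \<inter> space \<mu>)"
    using m rotation_invariant_prob_cap_sets[OF \<mu>] by (rule emeasure_distr)
  also have "mat_apply n U -` cap n y r \<inter> space \<mu> = cap n x r"
    by (auto simp: cap_def sp mat_apply_sphere[OF U(1)] U(2)[symmetric] mat_apply_diff mat_apply_sq_norm[OF U(1)])
  finally show ?thesis ..
qed

lemma sq_norm_diff_commute: "sq_norm n (\<lambda>i. x i - y i) = sq_norm n (\<lambda>i. y i - x i)"
  by (simp add: sq_norm_def power2_commute)

lemma sq_norm_diff_triangle:
  "sq_norm n (\<lambda>i. x i - z i) \<le> 2 * sq_norm n (\<lambda>i. x i - y i) + 2 * sq_norm n (\<lambda>i. y i - z i)"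
proof -
  have "(x i - z i)\<^sup>2 \<le> 2 * (x i - y i)\<^sup>2 + 2 * (y i - z i)\<^sup>2" for i
    using sum_squares_bound[of "x i - y i" "y i - z i"]
    by (simp add: power2_eq_square algebra_simps)
  then show ?thesis
    by (simp add: sq_norm_def sum_distrib_left flip: sum.distrib) (intro sum_mono, simp)
qed

text \<open>Countably many sets of small diameter cover the sphere.\<close>

lemma emeasure_cap_pos:
  assumes \<mu>: "rotation_invariant_prob n \<mu>" and x: "x \<in> unit_sphere n" and "0 < r"
  shows "emeasure \<mu> (cap n x r) \<noteq> 0"
proof
  assume 0: "emeasure \<mu> (cap n x r) = 0"
  interpret prob_space \<mu> using \<mu> by (simp add: rotation_invariant_prob_def)
  have sp: "space \<mu> = unit_sphere n" using \<mu> by (simp add: rotation_invariant_prob_def)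
  define Q where "Q = ({..<n} \<rightarrow>\<^sub>E (\<rat> :: real set))"
  \<comment> \<open>A rational centre \<open>q\<close> is in general not on the sphere, so the
    hypothesis cannot be applied to it. A nonempty cap of parameter \<open>r / 4\<close> about
    \<open>q\<close> lies in the cap of parameter \<open>r\<close> about any of its own points, as 2
    r/4 + 2 r/4 = r.\<close>
  have null: "cap n q (r / 4) \<in> null_sets \<mu>" for q
  proof (cases "cap n q (r / 4) = {}")
    case False
    then obtain y where y: "y \<in> cap n q (r / 4)" by blast
    have "cap n q (r / 4) \<subseteq> cap n y r"
    proof
      fix z assume "z \<in> cap n q (r / 4)"
      then show "z \<in> cap n y r"
        using y sq_norm_diff_triangle[of n y z q] sq_norm_diff_commute[of n y q] by (auto simp: cap_def)
    qed
    moreover have "cap n y r \<in> null_sets \<mu>"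
      using 0 emeasure_cap_const[OF \<mu> x, of y r] y rotation_invariant_prob_cap_sets[OF \<mu>]
      by (auto simp: null_sets_def cap_def)
    ultimately show ?thesis
      using null_sets_subset rotation_invariant_prob_cap_sets[OF \<mu>] by blast
  qed simp
  have "unit_sphere n \<subseteq> (\<Union>q\<in>Q. cap n q (r / 4))"
  proof
    fix y assume y: "y \<in> unit_sphere n"
    \<comment> \<open>Dividing by \<open>n + 1\<close> instead of \<open>n\<close> makes
      \<open>n * e^2\<close> strictly smaller than \<open>r / 4\<close>, also for
      \<open>n = 0\<close>.\<close>
    define e where "e = sqrt (r / 4 / (n + 1))"
    have e: "0 < e" "e\<^sup>2 = r / 4 / (n + 1)" using \<open>0 < r\<close> by (auto simp: e_def)
    have "\<forall>i. \<exists>q. q \<in> \<rat> \<and> y i < q \<and> q < y i + e"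
      using Rats_dense_in_real e by (metis less_add_same_cancel1)
    from choice[OF this] obtain q where q: "\<And>i. q i \<in> \<rat>" "\<And>i. y i < q i" "\<And>i. q i < y i + e"
      by blast
    define q' where "q' = restrict q {..<n}"
    have "sq_norm n (\<lambda>i. q' i - y i) \<le> (\<Sum>i<n. e\<^sup>2)"
      unfolding sq_norm_def q'_def
    proof (intro sum_mono)
      fix i assume "i \<in> {..<n}"
      then show "(restrict q {..<n} i - y i)\<^sup>2 \<le> e\<^sup>2"
        using q(2,3)[of i] by (intro power_mono) auto
    qed
    also have "\<dots> < r / 4" using \<open>0 < r\<close> by (simp add: e(2) field_simps)
    finally have "y \<in> cap n q' (r / 4)" using y by (simp add: cap_def)
    moreover have "q' \<in> Q" using q(1) by (simp add: Q_def q'_def)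
    ultimately show "y \<in> (\<Union>q\<in>Q. cap n q (r / 4))" by blast
  qed
  moreover have "countable Q"
    unfolding Q_def by (intro countable_PiE) (auto simp: countable_rat)
  then have "(\<Union>q\<in>Q. cap n q (r / 4)) \<in> null_sets \<mu>"
    using null by (intro null_sets_UN') auto
  ultimately have "space \<mu> \<in> null_sets \<mu>"
    using null_sets_subset[of _ \<mu> "space \<mu>"] by (simp add: sp[symmetric])
  then show False using emeasure_space_1 by (auto simp: null_sets_def)
qed

lemma unit_sphere_nonempty: "rotation_invariant_prob n \<mu> \<Longrightarrow> unit_sphere n \<noteq> {}"
  using prob_space.not_empty[of \<mu>] by (auto simp: rotation_invariant_prob_def)

text \<open>Both sides are the mass, under the product measure, of the pairs of points of
  \<open>A\<close> at squared distance below \<open>r\<close>; this relation is symmetric.\<close>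

lemma cap_Fubini:
  assumes \<mu>: "rotation_invariant_prob n \<mu>" and \<nu>: "rotation_invariant_prob n \<nu>"
    and A: "A \<in> sets (Pi\<^sub>M {..<n} (\<lambda>_. borel))" "A \<subseteq> unit_sphere n"
  shows "(\<integral>\<^sup>+x. emeasure \<nu> (A \<inter> cap n x r) * indicator A x \<partial>\<mu>) = (\<integral>\<^sup>+y. emeasure \<mu> (A \<inter> cap n y r) * indicator A y \<partial>\<nu>)"
    and "(\<lambda>x. emeasure \<nu> (A \<inter> cap n x r)) \<in> borel_measurable \<mu>"
proof -
  interpret M: prob_space \<mu> using \<mu> by (simp add: rotation_invariant_prob_def)
  interpret N: prob_space \<nu> using \<nu> by (simp add: rotation_invariant_prob_def)
  interpret P: pair_sigma_finite \<mu> \<nu> ..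
  have [measurable]: "(\<lambda>x. x) \<in> \<mu> \<rightarrow>\<^sub>M Pi\<^sub>M {..<n} (\<lambda>_. borel)" "(\<lambda>x. x) \<in> \<nu> \<rightarrow>\<^sub>M Pi\<^sub>M {..<n} (\<lambda>_. borel)"
    using \<mu> \<nu> rotation_invariant_prob_measurable_id by auto
  have mc: "(\<lambda>x. x i) \<in> borel_measurable \<mu>" "(\<lambda>x. x i) \<in> borel_measurable \<nu>" if "i < n" for i
    using measurable_compose[OF _ measurable_component_singleton[of i "{..<n}" "\<lambda>_. borel"]] that by auto
  have [measurable]: "A \<in> sets \<mu>" "A \<in> sets \<nu>"
    using A by (auto simp: rotation_invariant_prob_sets[OF \<mu>] rotation_invariant_prob_sets[OF \<nu>])
  let ?f = "\<lambda>x y. indicator A x * indicator A y * indicator {p. sq_norm n (\<lambda>i. fst p i - snd p i) < r} (x, y) :: ennreal"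
  have [measurable]: "(\<lambda>p. sq_norm n (\<lambda>i. fst p i - snd p i)) \<in> borel_measurable (\<mu> \<Otimes>\<^sub>M \<nu>)"
    unfolding sq_norm_def
  proof (intro borel_measurable_sum)
    fix i assume "i \<in> {..<n}"
    then have [measurable]: "(\<lambda>x. x i) \<in> borel_measurable \<mu>" "(\<lambda>x. x i) \<in> borel_measurable \<nu>" using mc by auto
    show "(\<lambda>p. (fst p i - snd p i)\<^sup>2) \<in> borel_measurable (\<mu> \<Otimes>\<^sub>M \<nu>)" by measurable
  qed
  have f: "case_prod ?f \<in> borel_measurable (\<mu> \<Otimes>\<^sub>M \<nu>)"
    unfolding case_prod_beta' prod.collapse by measurable
  have 1: "emeasure \<nu> (A \<inter> cap n x r) * indicator A x = (\<integral>\<^sup>+y. ?f x y \<partial>\<nu>)" for x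
  proof -
    have "emeasure \<nu> (A \<inter> cap n x r) * indicator A x = (\<integral>\<^sup>+y. indicator A x * indicator (A \<inter> cap n x r) y \<partial>\<nu>)"
      using rotation_invariant_prob_cap_sets[OF \<nu>] by (subst nn_integral_cmult_indicator) (auto simp: mult.commute)
    also have "\<dots> = (\<integral>\<^sup>+y. ?f x y \<partial>\<nu>)"
      using A(2) by (intro nn_integral_cong) (auto simp: cap_def indicator_def)
    finally show ?thesis .
  qed
  have 2: "emeasure \<mu> (A \<inter> cap n y r) * indicator A y = (\<integral>\<^sup>+x. ?f x y \<partial>\<mu>)" for y
  proof -
    have "emeasure \<mu> (A \<inter> cap n y r) * indicator A y = (\<integral>\<^sup>+x. indicator A y * indicator (A \<inter> cap n y r) x \<partial>\<mu>)"
      using rotation_invariant_prob_cap_sets[OF \<mu>] by (subst nn_integral_cmult_indicator) (auto simp: mult.commute)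
    also have "\<dots> = (\<integral>\<^sup>+x. ?f x y \<partial>\<mu>)"
      using A(2) sq_norm_diff_commute[of n y] by (intro nn_integral_cong) (auto simp: cap_def indicator_def)
    finally show ?thesis .
  qed
  show "(\<integral>\<^sup>+x. emeasure \<nu> (A \<inter> cap n x r) * indicator A x \<partial>\<mu>) = (\<integral>\<^sup>+y. emeasure \<mu> (A \<inter> cap n y r) * indicator A y \<partial>\<nu>)"
    unfolding 1 2 by (rule P.Fubini'[OF f, symmetric])
  show "(\<lambda>x. emeasure \<nu> (A \<inter> cap n x r)) \<in> borel_measurable \<mu>"
  proof -
    let ?Q = "{p \<in> space (\<mu> \<Otimes>\<^sub>M \<nu>). snd p \<in> A \<and> sq_norm n (\<lambda>i. fst p i - snd p i) < r}"
    have "?Q \<in> sets (\<mu> \<Otimes>\<^sub>M \<nu>)" by measurable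
    then have "(\<lambda>x. emeasure \<nu> (Pair x -` ?Q)) \<in> borel_measurable \<mu>"
      by (rule N.measurable_emeasure_Pair)
    also have "?this \<longleftrightarrow> ?thesis"
      using A(2) \<nu> by (intro measurable_cong arg_cong[where f="emeasure \<nu>"])
        (auto simp: cap_def space_pair_measure rotation_invariant_prob_def)
    finally show ?thesis .
  qed
qed

text \<open>If \<open>A\<close> is the whole sphere, the integrands in \<open>cap_Fubini\<close> are
  constant, and integrating a constant against a probability measure returns it.\<close>

lemma emeasure_cap_eq:
  assumes \<mu>: "rotation_invariant_prob n \<mu>" and \<nu>: "rotation_invariant_prob n \<nu>"
    and x: "x \<in> unit_sphere n"
  shows "emeasure \<mu> (cap n x r) = emeasure \<nu> (cap n x r)"
proof -
  have *: "(\<integral>\<^sup>+y. emeasure \<nu> (unit_sphere n \<inter> cap n y r) * indicator (unit_sphere n) y \<partial>\<mu>) = emeasure \<nu> (cap n x r)"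
    if \<mu>: "rotation_invariant_prob n \<mu>" and \<nu>: "rotation_invariant_prob n \<nu>" for \<mu> \<nu>
  proof -
    interpret M: prob_space \<mu> using \<mu> by (simp add: rotation_invariant_prob_def)
    have sp: "space \<mu> = unit_sphere n" using \<mu> by (simp add: rotation_invariant_prob_def)
    have "(\<integral>\<^sup>+y. emeasure \<nu> (unit_sphere n \<inter> cap n y r) * indicator (unit_sphere n) y \<partial>\<mu>) = (\<integral>\<^sup>+y. emeasure \<nu> (cap n x r) \<partial>\<mu>)"
    proof (rule nn_integral_cong)
      fix y assume "y \<in> space \<mu>"
      then have "y \<in> unit_sphere n" by (simp add: sp)
      moreover have "unit_sphere n \<inter> cap n y r = cap n y r" by (auto simp: cap_def)
      ultimately show "emeasure \<nu> (unit_sphere n \<inter> cap n y r) * indicator (unit_sphere n) y = emeasure \<nu> (cap n x r)"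
        using emeasure_cap_const[OF \<nu> x, of y r] by simp
    qed
    then show ?thesis by (simp add: M.emeasure_space_1)
  qed
  show ?thesis
    using *[OF \<mu> \<nu>] *[OF \<nu> \<mu>] cap_Fubini(1)[OF \<mu> \<nu> sets_unit_sphere order_refl, of r] by simp
qed

text \<open>Christensen's argument: \<open>\<nu> (A \<inter> B(x, r)) / \<nu> (B(x, r))\<close> tends to 1 at every interior
  point \<open>x\<close> of \<open>A\<close>, and the denominator depends neither on \<open>x\<close> nor on the measure.\<close>

lemma rotation_invariant_prob_open_le:
  assumes \<mu>: "rotation_invariant_prob n \<mu>" and \<nu>: "rotation_invariant_prob n \<nu>"
    and A: "A \<in> sets (Pi\<^sub>M {..<n} (\<lambda>_. borel))" "A \<subseteq> unit_sphere n"
    and op: "\<And>x. x \<in> A \<Longrightarrow> \<exists>r>0. cap n x r \<subseteq> A"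
  shows "emeasure \<mu> A \<le> emeasure \<nu> A"
proof -
  interpret M: prob_space \<mu> using \<mu> by (simp add: rotation_invariant_prob_def)
  interpret N: prob_space \<nu> using \<nu> by (simp add: rotation_invariant_prob_def)
  obtain x0 where x0: "x0 \<in> unit_sphere n" using unit_sphere_nonempty[OF \<mu>] by blast
  define r where "r k = 1 / real (Suc k)" for k
  define h where "h k = emeasure \<mu> (cap n x0 (r k))" for k
  have h0: "h k \<noteq> 0" "h k \<noteq> \<infinity>" for k
    using emeasure_cap_pos[OF \<mu> x0, of "r k"] by (auto simp: h_def r_def M.emeasure_finite)
  have h\<mu>: "emeasure \<mu> (cap n x (r k)) = h k" if "x \<in> unit_sphere n" for x k
    unfolding h_def by (rule emeasure_cap_const[OF \<mu> that x0])
  have h\<nu>: "emeasure \<nu> (cap n x (r k)) = h k" if "x \<in> unit_sphere n" for x k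
    using h\<mu>[OF that] emeasure_cap_eq[OF \<mu> \<nu> that] by simp
  have A\<mu>[measurable]: "A \<in> sets \<mu>" and A\<nu>[measurable]: "A \<in> sets \<nu>"
    using A by (auto simp: rotation_invariant_prob_sets[OF \<mu>] rotation_invariant_prob_sets[OF \<nu>])
  define F where "F k x = emeasure \<nu> (A \<inter> cap n x (r k)) * indicator A x / h k" for k x
  note [measurable] = cap_Fubini(2)[OF \<mu> \<nu> A]
  have Fm[measurable]: "F k \<in> borel_measurable \<mu>" for k
    unfolding F_def[abs_def] by measurable
  have F1: "indicator A x \<le> liminf (\<lambda>k. F k x)" for x
  proof (cases "x \<in> A")
    case True
    then obtain s where s: "0 < s" "cap n x s \<subseteq> A" using op by blast
    have "r \<longlonglongrightarrow> 0" unfolding r_def by (rule LIMSEQ_inverse_real_of_nat[unfolded inverse_eq_divide])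
    then have ev: "\<forall>\<^sub>F k in sequentially. r k < s" using s(1) by (rule order_tendstoD)
    have "\<forall>\<^sub>F k in sequentially. 1 \<le> F k x"
      using ev
    proof eventually_elim
      case (elim k)
      then have "A \<inter> cap n x (r k) = cap n x (r k)" using s(2) by (auto simp: cap_def)
      then show ?case using True A(2) h\<nu>[of x k] h0[of k] by (auto simp: F_def ennreal_divide_self top.not_eq_extremum)
    qed
    then have "1 \<le> liminf (\<lambda>k. F k x)" by (rule Liminf_bounded)
    then show ?thesis using True by simp
  qed simp
  \<comment> \<open>Interchanging the integrals replaces the cap mass of \<open>\<nu>\<close> inside
    \<open>A\<close> by that of \<open>\<mu>\<close>, which is at most the full mass
    \<open>h k\<close> and cancels the denominator. So \<open>F1\<close> uses \<open>h k\<close> as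
    the cap mass of \<open>\<nu>\<close> and \<open>F2\<close> uses it as the cap mass of
    \<open>\<mu>\<close>; Fatou's lemma combines them.\<close>
  have F2: "(\<integral>\<^sup>+x. F k x \<partial>\<mu>) \<le> emeasure \<nu> A" for k
  proof -
    have "(\<integral>\<^sup>+x. F k x \<partial>\<mu>) = (\<integral>\<^sup>+x. emeasure \<nu> (A \<inter> cap n x (r k)) * indicator A x \<partial>\<mu>) / h k"
      unfolding F_def by (rule nn_integral_divide) measurable
    also have "\<dots> = (\<integral>\<^sup>+y. emeasure \<mu> (A \<inter> cap n y (r k)) * indicator A y \<partial>\<nu>) / h k"
      by (subst cap_Fubini(1)[OF \<mu> \<nu> A]) (rule refl)
    also have "\<dots> \<le> (\<integral>\<^sup>+y. h k * indicator A y \<partial>\<nu>) / h k"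
    proof (intro divide_right_mono_ennreal nn_integral_mono)
      fix y
      show "emeasure \<mu> (A \<inter> cap n y (r k)) * indicator A y \<le> h k * indicator A y"
        using A(2) h\<mu>[of y k] emeasure_mono[of "A \<inter> cap n y (r k)" "cap n y (r k)" \<mu>]
          rotation_invariant_prob_cap_sets[OF \<mu>]
        by (auto simp: indicator_def)
    qed
    also have "(\<integral>\<^sup>+y. h k * indicator A y \<partial>\<nu>) = emeasure \<nu> A * h k"
      by (simp add: nn_integral_cmult_indicator mult.commute)
    also have "\<dots> / h k = emeasure \<nu> A"
      using h0[of k] by (simp add: ennreal_mult_divide_eq)
    finally show ?thesis .
  qed
  have "emeasure \<mu> A = (\<integral>\<^sup>+x. indicator A x \<partial>\<mu>)" by simp
  also have "\<dots> \<le> (\<integral>\<^sup>+x. liminf (\<lambda>k. F k x) \<partial>\<mu>)" by (intro nn_integral_mono F1)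
  also have "\<dots> \<le> liminf (\<lambda>k. \<integral>\<^sup>+x. F k x \<partial>\<mu>)" by (intro nn_integral_liminf) measurable
  also have "\<dots> \<le> emeasure \<nu> A"
    by (intro Liminf_le always_eventually allI F2) simp
  finally show ?thesis .
qed

text \<open>The inequality for open sets holds in both directions. Traces of open boxes suffice,
  since open boxes are stable under intersection and generate the product sigma-algebra.\<close>

lemma rotation_invariant_prob_unique:
  assumes \<mu>: "rotation_invariant_prob n \<mu>" and \<nu>: "rotation_invariant_prob n \<nu>"
  shows "\<mu> = \<nu>"
proof -
  let ?P = "Pi\<^sub>M {..<n} (\<lambda>_. borel :: real measure)"
  let ?O = "\<lambda>_ :: nat. {S :: real set. open S}"
  let ?E = "{{f \<in> Pi\<^sub>E {..<n} (\<lambda>_. UNIV :: real set). \<forall>i\<in>j. f i \<in> A i} |A j. j \<in> {{..<n}} \<and> A \<in> Pi j ?O}"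
  \<comment> \<open>\<open>?E\<close> has the shape of the generator in
    \<open>sets_PiM_sigma\<close>, with the full index set as the only admissible set of
    coordinates; \<open>E\<close> is the same family written as boxes.\<close>
  define E where "E = {Pi\<^sub>E {..<n} A |A :: nat \<Rightarrow> real set. \<forall>i<n. open (A i)}"
  have E_alt: "?E = E"
  proof -
    have *: "{f \<in> Pi\<^sub>E {..<n} (\<lambda>_. UNIV). \<forall>i\<in>{..<n}. f i \<in> A i} = Pi\<^sub>E {..<n} A" for A :: "nat \<Rightarrow> real set"
      by (simp only: set_eq_iff PiE_iff mem_Collect_eq UNIV_I simp_thms) blast
    have "?E = {{f \<in> Pi\<^sub>E {..<n} (\<lambda>_. UNIV). \<forall>i\<in>{..<n}. f i \<in> A i} |A. A \<in> Pi {..<n} ?O}"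
      by blast
    also have "\<dots> = E" unfolding * E_def by (simp add: Pi_iff Ball_def)
    finally show ?thesis .
  qed
  have sets_P: "sets ?P = sigma_sets ({..<n} \<rightarrow>\<^sub>E UNIV) E"
  proof -
    have "sets ?P = sets (Pi\<^sub>M {..<n} (\<lambda>_. sigma UNIV {S :: real set. open S}))"
      by (simp add: borel_def)
    also have "\<dots> = sets (sigma ({..<n} \<rightarrow>\<^sub>E UNIV) E)"
      unfolding E_alt[symmetric]
      by (rule sets_PiM_sigma[where \<Omega>="\<lambda>_. UNIV" and E="?O" and I="{..<n}" and J="{{..<n}}"]) (auto intro!: exI[of _ "{UNIV}"])
    also have "\<dots> = sigma_sets ({..<n} \<rightarrow>\<^sub>E UNIV) E"
      by (rule sets_measure_of) (auto simp: E_def)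
    finally show ?thesis .
  qed
  have op: "\<exists>r>0. cap n x r \<subseteq> X \<inter> unit_sphere n" if "X \<in> E" "x \<in> X" for X x
  proof -
    obtain A where X: "X = Pi\<^sub>E {..<n} A" and A: "\<forall>i<n. open (A i)"
      using \<open>X \<in> E\<close> unfolding E_def by blast
    have "\<exists>e>0. \<forall>t. \<bar>t - x i\<bar> < e \<longrightarrow> t \<in> A i" if "i < n" for i
    proof -
      have "x i \<in> A i" using \<open>x \<in> X\<close> that by (auto simp: X PiE_iff)
      then show ?thesis using A that unfolding open_dist dist_real_def by blast
    qed
    then have "\<forall>i. \<exists>e. i < n \<longrightarrow> 0 < e \<and> (\<forall>t. \<bar>t - x i\<bar> < e \<longrightarrow> t \<in> A i)" by blast
    from choice[OF this] obtain e where e: "\<And>i. i < n \<Longrightarrow> 0 < e i" "\<And>i t. i < n \<Longrightarrow> \<bar>t - x i\<bar> < e i \<Longrightarrow> t \<in> A i"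
      by blast
    \<comment> \<open>The inserted 1 keeps the minimum defined when there are no
      coordinates.\<close>
    define d where "d = Min (insert 1 (e ` {..<n}))"
    have d: "0 < d" "\<And>i. i < n \<Longrightarrow> d \<le> e i" using e(1) by (auto simp: d_def)
    have "cap n x (d\<^sup>2) \<subseteq> X \<inter> unit_sphere n"
    proof
      fix y assume y: "y \<in> cap n x (d\<^sup>2)"
      have "y i \<in> A i" if i: "i < n" for i
      proof -
        have "(x i - y i)\<^sup>2 \<le> sq_norm n (\<lambda>i. x i - y i)"
          unfolding sq_norm_def using i by (intro member_le_sum) auto
        also have "\<dots> < d\<^sup>2" using y by (simp add: cap_def)
        finally have "\<bar>x i - y i\<bar> < d" using d(1) power2_less_imp_less[of "\<bar>x i - y i\<bar>" d] by simp
        then show ?thesis using e(2)[OF i] d(2)[OF i] by (simp add: abs_minus_commute)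
      qed
      then show "y \<in> X \<inter> unit_sphere n"
        using y by (auto simp: X PiE_iff cap_def unit_sphere_iff)
    qed
    then show ?thesis using d(1) by (intro exI[of _ "d\<^sup>2"]) auto
  qed
  have eq: "emeasure \<mu> (X \<inter> unit_sphere n) = emeasure \<nu> (X \<inter> unit_sphere n)" if X: "X \<in> E" for X
  proof -
    have "X \<in> sets ?P" unfolding sets_P using X by (rule sigma_sets.Basic)
    then have XP: "X \<inter> unit_sphere n \<in> sets ?P" by auto
    have o: "\<exists>r>0. cap n x r \<subseteq> X \<inter> unit_sphere n" if "x \<in> X \<inter> unit_sphere n" for x
      using op[OF X] that by blast
    show ?thesis
      using rotation_invariant_prob_open_le[OF \<mu> \<nu> XP _ o] rotation_invariant_prob_open_le[OF \<nu> \<mu> XP _ o]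
      by (intro antisym) auto
  qed
  \<comment> \<open>The generator consists of subsets of the whole space, so both measures are first
    pushed forward along the inclusion of the sphere.\<close>
  have D: "emeasure (distr \<kappa> ?P (\<lambda>x. x)) X = emeasure \<kappa> (X \<inter> unit_sphere n)"
    if "rotation_invariant_prob n \<kappa>" "X \<in> sets ?P" for \<kappa> X
    using that rotation_invariant_prob_measurable_id[OF that(1)]
    by (subst emeasure_distr) (auto simp: rotation_invariant_prob_def)
  have "distr \<mu> ?P (\<lambda>x. x) = distr \<nu> ?P (\<lambda>x. x)"
  proof (rule measure_eqI_generator_eq[where E=E and \<Omega>="{..<n} \<rightarrow>\<^sub>E UNIV" and A="\<lambda>_. {..<n} \<rightarrow>\<^sub>E UNIV"])
    show "Int_stable E"
      unfolding Int_stable_def E_def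
    proof safe
      fix A B :: "nat \<Rightarrow> real set" assume "\<forall>i<n. open (A i)" "\<forall>i<n. open (B i)"
      then show "\<exists>C. Pi\<^sub>E {..<n} A \<inter> Pi\<^sub>E {..<n} B = Pi\<^sub>E {..<n} C \<and> (\<forall>i<n. open (C i))"
        by (intro exI[of _ "\<lambda>i. A i \<inter> B i"]) (auto simp: PiE_Int)
    qed
    show "E \<subseteq> Pow ({..<n} \<rightarrow>\<^sub>E UNIV)" by (auto simp: E_def)
    show "emeasure (distr \<mu> ?P (\<lambda>x. x)) X = emeasure (distr \<nu> ?P (\<lambda>x. x)) X" if "X \<in> E" for X
      using that eq[OF that] by (simp add: D[OF \<mu>] D[OF \<nu>] sets_P sigma_sets.Basic)
    show "range (\<lambda>_. {..<n} \<rightarrow>\<^sub>E UNIV) \<subseteq> E" by (auto simp: E_def intro!: exI[of _ "\<lambda>_. UNIV"])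
    show "emeasure (distr \<mu> ?P (\<lambda>x. x)) ({..<n} \<rightarrow>\<^sub>E UNIV) \<noteq> \<infinity>"
      using D[OF \<mu>, of "space ?P"] \<mu> finite_measure.emeasure_finite[of \<mu>]
      by (auto simp: space_PiM rotation_invariant_prob_def prob_space_def)
  qed (auto simp: sets_P)
  then have "emeasure \<mu> X = emeasure \<nu> X" if "X \<in> sets \<mu>" for X
    using D[OF \<mu>, of X] D[OF \<nu>, of X] that
    by (simp add: rotation_invariant_prob_sets[OF \<mu>] Int_absorb2)
  then show ?thesis
    using \<mu> \<nu> by (intro measure_eqI) (auto simp: rotation_invariant_prob_def)
qed

subsection \<open>The Gaussian model of the sphere\<close>

text \<open>Radial projection. The origin is sent to the first basis vector so that for
  \<open>n > 0\<close> every value lies on the sphere; this choice concerns a null set.\<close>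

definition sphere_proj :: "nat \<Rightarrow> (nat \<Rightarrow> real) \<Rightarrow> nat \<Rightarrow> real" where
  "sphere_proj n x =
     (\<lambda>i\<in>{..<n}. if sq_norm n x = 0 then (if i = 0 then 1 else 0) else x i / sqrt (sq_norm n x))"

lemma sphere_proj_sphere:
  assumes "0 < n"
  shows "sphere_proj n x \<in> unit_sphere n"
proof (cases "sq_norm n x = 0")
  case True
  have "sq_norm n (sphere_proj n x) = (\<Sum>i<n. if i = 0 then 1 else 0)"
    using True unfolding sq_norm_def sphere_proj_def by (intro sum.cong) auto
  then show ?thesis using assms by (simp add: unit_sphere_iff) (simp add: sphere_proj_def)
next
  case False
  then have pos: "0 < sq_norm n x" using sq_norm_nonneg[of n x] by simp
  have "sq_norm n (sphere_proj n x) = (\<Sum>i<n. (x i)\<^sup>2 / sq_norm n x)"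
    using False pos by (subst sq_norm_def, intro sum.cong) (auto simp: sphere_proj_def power_divide)
  also have "\<dots> = 1" using False by (simp add: sum_divide_distrib[symmetric] sq_norm_def[symmetric])
  finally show ?thesis by (simp add: unit_sphere_iff) (simp add: sphere_proj_def)
qed

lemma measurable_sphere_proj_PiM: "sphere_proj n \<in> gauss_n n \<rightarrow>\<^sub>M Pi\<^sub>M {..<n} (\<lambda>_. borel)"
  unfolding sphere_proj_def[abs_def] by measurable

lemma measurable_sphere_proj:
  assumes "0 < n"
  shows "sphere_proj n \<in> gauss_n n \<rightarrow>\<^sub>M restrict_space (Pi\<^sub>M {..<n} (\<lambda>_. borel)) (unit_sphere n)"
  using sphere_proj_sphere[OF assms] measurable_sphere_proj_PiM by (intro measurable_restrict_space2) auto

lemma mat_apply_sphere_proj: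
  assumes "orthogonal_mat n U" "sq_norm n x \<noteq> 0"
  shows "mat_apply n U (sphere_proj n x) = sphere_proj n (mat_apply n U x)"
  using assms(2) mat_apply_sq_norm[OF assms(1), of x]
  by (auto simp: sphere_proj_def mat_apply_def fun_eq_iff sum_divide_distrib)

lemma AE_gauss_n_nonzero:
  assumes "0 < n"
  shows "AE x in gauss_n n. sq_norm n x \<noteq> 0"
proof -
  interpret L: product_sigma_finite "\<lambda>_::nat. lborel :: real measure" ..
  let ?A = "\<lambda>i::nat. {0 :: real}"
  have "emeasure (lebesgue_n n) (Pi\<^sub>E {..<n} ?A) = 0"
    unfolding lebesgue_n_def using assms by (subst L.emeasure_PiM) auto
  then have "Pi\<^sub>E {..<n} ?A \<in> null_sets (lebesgue_n n)"
    using sets_PiM_I_finite[of "{..<n}" ?A "\<lambda>_. borel"] by (auto simp: null_sets_def sets_lebesgue_n)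
  then have "AE x in lebesgue_n n. sq_norm n x \<noteq> 0"
    by (rule AE_I')
      (auto simp: sq_norm_def sum_nonneg_eq_0_iff space_lebesgue_n PiE_iff extensional_def fun_eq_iff)
  then show ?thesis
    unfolding gauss_n_eq_density by (subst AE_density) auto
qed

text \<open>Radial projection commutes with orthogonal maps, and so hands the invariance of the
  Gaussian measure on to the sphere. At the origin the artificial value breaks this, hence the
  comparison almost everywhere.\<close>

lemma rotation_invariant_prob_gauss:
  assumes n: "0 < n"
  shows "rotation_invariant_prob n (distr (gauss_n n) (restrict_space (Pi\<^sub>M {..<n} (\<lambda>_. borel)) (unit_sphere n)) (sphere_proj n))"
    (is "rotation_invariant_prob n ?S")
  unfolding rotation_invariant_prob_def
proof (intro conjI allI impI)
  let ?K = "restrict_space (Pi\<^sub>M {..<n} (\<lambda>_. borel :: real measure)) (unit_sphere n)"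
  note m = measurable_sphere_proj[OF n]
  show "prob_space ?S"
    using m by (rule prob_space.prob_space_distr[OF prob_space_gauss_n])
  show "space ?S = unit_sphere n"
    by (auto simp: space_restrict_space space_PiM unit_sphere_def)
  fix U assume U: "orthogonal_mat n U"
  have mU: "mat_apply n U \<in> ?K \<rightarrow>\<^sub>M ?K"
    by (intro measurable_restrict_space2 measurable_restrict_space1 measurable_mat_apply)
      (auto simp: space_restrict_space intro!: mat_apply_sphere U)
  have mG: "mat_apply n U \<in> gauss_n n \<rightarrow>\<^sub>M gauss_n n" by measurable
  have "distr ?S ?S (mat_apply n U) = distr ?S ?K (mat_apply n U)"
    by (rule distr_cong) auto
  also have "\<dots> = distr (gauss_n n) ?K (\<lambda>x. mat_apply n U (sphere_proj n x))"
    using distr_distr[OF mU m] by (simp add: comp_def)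
  also have "\<dots> = distr (gauss_n n) ?K (\<lambda>x. sphere_proj n (mat_apply n U x))"
  proof (rule distr_cong_AE)
    show "AE x in gauss_n n. mat_apply n U (sphere_proj n x) = sphere_proj n (mat_apply n U x)"
      using AE_gauss_n_nonzero[OF n] by eventually_elim (rule mat_apply_sphere_proj[OF U])
    show "(\<lambda>x. mat_apply n U (sphere_proj n x)) \<in> gauss_n n \<rightarrow>\<^sub>M ?K"
      using m mU by (rule measurable_compose)
    show "(\<lambda>x. sphere_proj n (mat_apply n U x)) \<in> gauss_n n \<rightarrow>\<^sub>M ?K"
      using mG m by (rule measurable_compose)
  qed auto
  also have "\<dots> = distr (distr (gauss_n n) (gauss_n n) (mat_apply n U)) ?K (sphere_proj n)"
    using distr_distr[OF m mG] by (simp add: comp_def)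
  also have "\<dots> = ?S" by (simp add: gauss_n_rotate[OF U])
  finally show "distr ?S ?S (mat_apply n U) = ?S" .
qed simp

text \<open>Existence and uniqueness together make the description denote; from here on,
  probabilities on the sphere are Gaussian probabilities.\<close>

lemma sphere_measure_eq:
  assumes "0 < n"
  shows "sphere_measure n = distr (gauss_n n) (restrict_space (Pi\<^sub>M {..<n} (\<lambda>_. borel)) (unit_sphere n)) (sphere_proj n)"
  unfolding sphere_measure_def
  using rotation_invariant_prob_gauss[OF assms] rotation_invariant_prob_unique by (intro the_equality)

lemma rotation_invariant_prob_sphere_measure:
  "0 < n \<Longrightarrow> rotation_invariant_prob n (sphere_measure n)"
  using rotation_invariant_prob_gauss sphere_measure_eq by simp

lemma sup_norm_le_iff: "0 < n \<Longrightarrow> sup_norm n x \<le> t \<longleftrightarrow> (\<forall>i<n. \<bar>x i\<bar> \<le> t)"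
  unfolding sup_norm_def by (subst Max_le_iff) auto

lemma measurable_sup_norm [measurable]:
  assumes "0 < n"
  shows "sup_norm n \<in> borel_measurable (Pi\<^sub>M {..<n} (\<lambda>_. borel))"
proof (rule borel_measurableI_le)
  fix t
  have "{x \<in> space (Pi\<^sub>M {..<n} (\<lambda>_. borel :: real measure)). sup_norm n x \<le> t} = {x \<in> space (Pi\<^sub>M {..<n} (\<lambda>_. borel :: real measure)). \<forall>i\<in>{..<n}. \<bar>x i\<bar> \<le> t}"
    using assms by (auto simp: sup_norm_le_iff)
  also have "\<dots> \<in> sets (Pi\<^sub>M {..<n} (\<lambda>_. borel))" by measurable
  finally show "{x \<in> space (Pi\<^sub>M {..<n} (\<lambda>_. borel :: real measure)). sup_norm n x \<le> t} \<in> sets (Pi\<^sub>M {..<n} (\<lambda>_. borel))" .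
qed

section \<open>Exponential moments, tails and box probabilities of Gaussian vectors\<close>

lemma prob_space_gauss_1: "prob_space std_normal_distribution"
  using prob_space_normal_density[of 1 0] by simp

lemma nn_integral_gauss_1_exp_square:
  assumes "a < 1 / 2"
  shows "(\<integral>\<^sup>+x. ennreal (exp (a * x\<^sup>2)) \<partial>std_normal_distribution) = ennreal (1 / sqrt (1 - 2 * a))"
proof -
  \<comment> \<open>Multiplying the standard density by \<open>exp (a * x^2)\<close> gives
    \<open>\<sigma>\<close> times the centred normal density with this standard deviation.\<close>
  define \<sigma> where "\<sigma> = 1 / sqrt (1 - 2 * a)"
  have \<sigma>: "0 < \<sigma>" "\<sigma>\<^sup>2 = 1 / (1 - 2 * a)" using assms by (auto simp: \<sigma>_def power_divide)
  have eq: "std_normal_density x * exp (a * x\<^sup>2) = \<sigma> * normal_density 0 \<sigma> x" for x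
  proof -
    have "- (x\<^sup>2) / 2 + a * x\<^sup>2 = - (x\<^sup>2) / (2 * \<sigma>\<^sup>2)"
      using assms by (simp add: \<sigma>(2) field_simps)
    then show ?thesis
      using \<sigma>(1) by (simp add: normal_density_def exp_add[symmetric] real_sqrt_mult)
  qed
  have "(\<integral>\<^sup>+x. ennreal (exp (a * x\<^sup>2)) \<partial>std_normal_distribution) = (\<integral>\<^sup>+x. ennreal (\<sigma> * normal_density 0 \<sigma> x) \<partial>lborel)"
    by (subst nn_integral_density) (auto simp: ennreal_mult'[symmetric] eq)
  also have "\<dots> = ennreal (\<integral>x. \<sigma> * normal_density 0 \<sigma> x \<partial>lborel)"
    using \<sigma>(1) by (intro nn_integral_eq_integral) auto
  also have "\<dots> = ennreal \<sigma>" using \<sigma>(1) by simp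
  finally show ?thesis by (simp add: \<sigma>_def)
qed

lemma product_sigma_finite_gauss_1: "product_sigma_finite (\<lambda>_::nat. std_normal_distribution)"
  unfolding product_sigma_finite_def using prob_space_gauss_1 by (auto intro: prob_space_imp_sigma_finite)

lemma nn_integral_gauss_n_exp_sq_norm:
  assumes "a < 1 / 2"
  shows "(\<integral>\<^sup>+x. ennreal (exp (a * sq_norm n x)) \<partial>gauss_n n) = ennreal ((1 / sqrt (1 - 2 * a)) ^ n)"
proof -
  interpret product_sigma_finite "\<lambda>_::nat. std_normal_distribution" by (rule product_sigma_finite_gauss_1)
  have "ennreal (exp (a * sq_norm n x)) = (\<Prod>i<n. ennreal (exp (a * (x i)\<^sup>2)))" for x
    by (simp add: prod_ennreal sq_norm_def sum_distrib_left exp_sum)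
  then have "(\<integral>\<^sup>+x. ennreal (exp (a * sq_norm n x)) \<partial>gauss_n n) =
    (\<integral>\<^sup>+x. (\<Prod>i<n. ennreal (exp (a * (x i)\<^sup>2))) \<partial>gauss_n n)"
    by simp
  also have "\<dots> = (\<Prod>i<n. \<integral>\<^sup>+x. ennreal (exp (a * x\<^sup>2)) \<partial>std_normal_distribution)"
    unfolding gauss_n_def by (rule product_nn_integral_prod) auto
  finally show ?thesis
    using assms by (simp add: nn_integral_gauss_1_exp_square ennreal_power)
qed

text \<open>The Chernoff bound, with the exponential moment supplied in closed form.\<close>

lemma prob_exp_Markov:
  assumes "prob_space M" and [measurable]: "f \<in> borel_measurable M"
    and E: "(\<integral>\<^sup>+x. ennreal (exp (f x)) \<partial>M) = ennreal m" and "0 \<le> m"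
  shows "measure M {x \<in> space M. b \<le> f x} \<le> exp (- b) * m"
proof -
  interpret prob_space M by fact
  have "emeasure M {x \<in> space M. 1 \<le> ennreal (exp (- b)) * ennreal (exp (f x))} \<le>
    ennreal (exp (- b)) * (\<integral>\<^sup>+x. ennreal (exp (f x)) * indicator (space M) x \<partial>M)"
    by (rule nn_integral_Markov_inequality) auto
  also have "{x \<in> space M. 1 \<le> ennreal (exp (- b)) * ennreal (exp (f x))} = {x \<in> space M. b \<le> f x}"
    by (auto simp: ennreal_mult'[symmetric] exp_add[symmetric] ennreal_1[symmetric] simp del: ennreal_1)
  also have "(\<integral>\<^sup>+x. ennreal (exp (f x)) * indicator (space M) x \<partial>M) = ennreal m"
    unfolding E[symmetric] by (intro nn_integral_cong) auto
  finally show ?thesis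
    using \<open>0 \<le> m\<close> by (simp add: emeasure_eq_measure ennreal_mult'[symmetric])
qed

text \<open>The sign of \<open>a\<close> selects the tail: positive \<open>a\<close> controls large
  norms, negative \<open>a\<close> small ones.\<close>

lemma gauss_n_sq_norm_tail:
  assumes "a < 1 / 2"
  shows "measure (gauss_n n) {x \<in> space (gauss_n n). b \<le> a * sq_norm n x} \<le> exp (- b) * (1 / sqrt (1 - 2 * a)) ^ n"
  using assms by (intro prob_exp_Markov prob_space_gauss_n nn_integral_gauss_n_exp_sq_norm) auto

lemma gauss_n_sq_norm_large:
  "measure (gauss_n n) {x \<in> space (gauss_n n). 4 * real n \<le> sq_norm n x} \<le> exp (- real n / 2)"
proof -
  have "measure (gauss_n n) {x \<in> space (gauss_n n). 4 * real n \<le> sq_norm n x} \<le> exp (- real n) * sqrt 2 ^ n"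
    \<comment> \<open>With \<open>a = 1/4\<close> each coordinate contributes a factor sqrt 2, and
      sqrt 2 <= exp (1/2) consumes only half of the exponent \<open>n\<close>.\<close>
    using gauss_n_sq_norm_tail[of "1/4" n "real n"] by (simp add: mult.commute real_sqrt_divide)
  also have "sqrt 2 \<le> exp (1 / 2)"
  proof (rule real_le_lsqrt)
    show "2 \<le> (exp (1 / 2 :: real))\<^sup>2"
      using exp_ge_add_one_self[of "1::real"] by (simp add: power2_eq_square exp_add[symmetric])
  qed simp
  then have "exp (- real n) * sqrt 2 ^ n \<le> exp (- real n) * exp (1 / 2) ^ n"
    by (intro mult_left_mono power_mono) auto
  also have "\<dots> = exp (- real n / 2)"
    by (simp add: exp_of_nat_mult[symmetric] exp_add[symmetric])
  finally show ?thesis .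
qed

text \<open>The constant is chosen so that the exponent is \<open>- 2 n\<close>: the lower bounds for boxes used below
  can be as small as \<open>exp (- n)\<close>.\<close>

lemma gauss_n_sq_norm_small:
  "measure (gauss_n n) {x \<in> space (gauss_n n). sq_norm n x \<le> 2 / (exp 6 - 1) * real n} \<le> exp (- 2 * real n)"
proof -
  \<comment> \<open>Chosen so that 1 + 2 a = exp 6: each coordinate then contributes exp (-3), which
    together with exp n leaves exp (-2n).\<close>
  let ?a = "(exp 6 - 1) / 2 :: real"
  have e6: "1 < exp (6::real)" by simp
  have "measure (gauss_n n) {x \<in> space (gauss_n n). - real n \<le> - ?a * sq_norm n x} \<le> exp (real n) * (1 / sqrt (1 - 2 * - ?a)) ^ n"
    using gauss_n_sq_norm_tail[of "- ?a" n "- real n"] e6 by simp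
  also have "{x \<in> space (gauss_n n). - real n \<le> - ?a * sq_norm n x} = {x \<in> space (gauss_n n). sq_norm n x \<le> 2 / (exp 6 - 1) * real n}"
    using e6 by (auto simp: field_simps)
  also have "1 / sqrt (1 - 2 * - ?a) = exp (- 3)"
  proof -
    have "sqrt (1 - 2 * - ?a) = sqrt ((exp 3)\<^sup>2)" by (simp add: power2_eq_square exp_add[symmetric] field_simps)
    then show ?thesis by (simp add: exp_minus inverse_eq_divide)
  qed
  also have "exp (real n) * exp (- 3) ^ n = exp (- 2 * real n)"
    by (simp add: exp_of_nat_mult[symmetric] exp_add[symmetric])
  finally show ?thesis .
qed

lemma gauss_1_interval_ge:
  assumes "0 \<le> t"
  shows "1 - sqrt 2 * exp (- t\<^sup>2 / 4) \<le> measure std_normal_distribution {- t..t}"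
proof -
  interpret prob_space std_normal_distribution by (rule prob_space_gauss_1)
  have "measure std_normal_distribution {x \<in> space std_normal_distribution. t\<^sup>2 / 4 \<le> 1 / 4 * x\<^sup>2} \<le> exp (- (t\<^sup>2 / 4)) * sqrt 2"
    using nn_integral_gauss_1_exp_square[of "1/4"]
    by (intro prob_exp_Markov prob_space_gauss_1) (auto simp: real_sqrt_divide)
  moreover have "measure std_normal_distribution (space std_normal_distribution - {- t..t}) \<le> measure std_normal_distribution {x \<in> space std_normal_distribution. t\<^sup>2 / 4 \<le> 1 / 4 * x\<^sup>2}"
  proof (rule finite_measure_mono)
    show "space std_normal_distribution - {- t..t} \<subseteq> {x \<in> space std_normal_distribution. t\<^sup>2 / 4 \<le> 1 / 4 * x\<^sup>2}"
    proof
      fix x assume "x \<in> space std_normal_distribution - {- t..t}"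
      then have "t \<le> \<bar>x\<bar>" by auto
      from power_mono[OF this assms, of 2] show "x \<in> {x \<in> space std_normal_distribution. t\<^sup>2 / 4 \<le> 1 / 4 * x\<^sup>2}"
        by simp
    qed
  qed measurable
  moreover have "measure std_normal_distribution (space std_normal_distribution - {- t..t}) = 1 - measure std_normal_distribution {- t..t}"
    by (rule prob_compl) simp
  ultimately show ?thesis by (simp add: mult.commute)
qed

text \<open>The factor 1 / sqrt (2 pi) is that of the normal density; 1 / exp 1 comes from (t + 1)^2
  / 2 <= t^2 + 1, which bounds the density from below on the unit interval to the right of
  \<open>t\<close>.\<close>

definition gauss_tail_const :: real where
  "gauss_tail_const = 1 / (sqrt (2 * pi) * exp 1)"

lemma gauss_1_interval_le:
  assumes "0 \<le> t"
  shows "measure std_normal_distribution {- t..t} \<le> 1 - gauss_tail_const * exp (- t\<^sup>2)"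
proof -
  interpret prob_space std_normal_distribution by (rule prob_space_gauss_1)
  have lb: "gauss_tail_const * exp (- t\<^sup>2) \<le> std_normal_density x" if "x \<in> {t<..t + 1}" for x
  proof -
    have "x\<^sup>2 \<le> (t + 1)\<^sup>2" using that assms by (intro power_mono) auto
    also have "\<dots> \<le> 2 * t\<^sup>2 + 2" using zero_le_power2[of "t - 1"] by (simp add: power2_eq_square algebra_simps)
    finally have "exp (- 1 + - t\<^sup>2) \<le> exp (- x\<^sup>2 / 2)" by simp
    then have "1 / sqrt (2 * pi) * (exp (- 1) * exp (- t\<^sup>2)) \<le> 1 / sqrt (2 * pi) * exp (- x\<^sup>2 / 2)"
      unfolding exp_add by (intro mult_left_mono) auto
    then show ?thesis by (simp add: std_normal_density_def gauss_tail_const_def exp_minus field_simps)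
  qed
  have "ennreal (gauss_tail_const * exp (- t\<^sup>2)) = (\<integral>\<^sup>+x. ennreal (gauss_tail_const * exp (- t\<^sup>2)) * indicator {t<..t + 1} x \<partial>lborel)"
    by (subst nn_integral_cmult_indicator) auto
  also have "\<dots> \<le> (\<integral>\<^sup>+x. ennreal (std_normal_density x) * indicator {t<..t + 1} x \<partial>lborel)"
    using lb by (intro nn_integral_mono) (auto simp: indicator_def intro!: ennreal_leI)
  also have "\<dots> = emeasure std_normal_distribution {t<..t + 1}"
    by (subst emeasure_density) auto
  finally have "gauss_tail_const * exp (- t\<^sup>2) \<le> measure std_normal_distribution {t<..t + 1}"
    by (simp add: emeasure_eq_measure)
  moreover have "measure std_normal_distribution {- t..t} + measure std_normal_distribution {t<..t + 1} = measure std_normal_distribution ({- t..t} \<union> {t<..t + 1})"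
    by (rule finite_measure_Union[symmetric]) auto
  ultimately show ?thesis using prob_le_1[of "{- t..t} \<union> {t<..t + 1}"] by linarith
qed

lemma gauss_n_box:
  "measure (gauss_n n) {x \<in> space (gauss_n n). \<forall>i<n. \<bar>x i\<bar> \<le> t} = measure std_normal_distribution {- t..t} ^ n"
proof -
  interpret product_sigma_finite "\<lambda>_::nat. std_normal_distribution" by (rule product_sigma_finite_gauss_1)
  interpret G: prob_space std_normal_distribution by (rule prob_space_gauss_1)
  have "{x \<in> space (gauss_n n). \<forall>i<n. \<bar>x i\<bar> \<le> t} = Pi\<^sub>E {..<n} (\<lambda>_. {- t..t})"
  proof (rule set_eqI)
    fix x :: "nat \<Rightarrow> real"
    have "\<bar>x i\<bar> \<le> t \<longleftrightarrow> x i \<in> {- t..t}" for i by (auto simp: abs_le_iff)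
    then show "x \<in> {x \<in> space (gauss_n n). \<forall>i<n. \<bar>x i\<bar> \<le> t} \<longleftrightarrow> x \<in> Pi\<^sub>E {..<n} (\<lambda>_. {- t..t})"
      by (simp add: space_gauss_n PiE_iff Ball_def conj_commute)
  qed
  then have "emeasure (gauss_n n) {x \<in> space (gauss_n n). \<forall>i<n. \<bar>x i\<bar> \<le> t} = ennreal (measure std_normal_distribution {- t..t} ^ n)"
    unfolding gauss_n_def by (simp add: emeasure_PiM G.emeasure_eq_measure ennreal_power)
  then show ?thesis by (simp add: measure_def)
qed

section \<open>Distribution of the maximum norm on the sphere\<close>

lemma sphere_measure_sup_norm_le_eq:
  assumes "0 < n"
  shows "measure (sphere_measure n) {\<theta> \<in> space (sphere_measure n). sup_norm n \<theta> \<le> s} =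
    measure (gauss_n n) {x \<in> space (gauss_n n). \<forall>i<n. \<bar>sphere_proj n x i\<bar> \<le> s}"
proof -
  let ?K = "restrict_space (Pi\<^sub>M {..<n} (\<lambda>_. borel :: real measure)) (unit_sphere n)"
  note m = measurable_sphere_proj[OF assms]
  have "{\<theta> \<in> space ?K. sup_norm n \<theta> \<le> s} \<in> sets ?K"
    using measurable_restrict_space1[OF measurable_sup_norm[OF assms]] by measurable
  then have "measure (sphere_measure n) {\<theta> \<in> space (sphere_measure n). sup_norm n \<theta> \<le> s} =
    measure (gauss_n n) (sphere_proj n -` {\<theta> \<in> space ?K. sup_norm n \<theta> \<le> s} \<inter> space (gauss_n n))"
    unfolding sphere_measure_eq[OF assms] by (subst measure_distr[OF m]) auto
  also have "sphere_proj n -` {\<theta> \<in> space ?K. sup_norm n \<theta> \<le> s} \<inter> space (gauss_n n) =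
    {x \<in> space (gauss_n n). \<forall>i<n. \<bar>sphere_proj n x i\<bar> \<le> s}"
    using measurable_space[OF m] by (auto simp: sup_norm_le_iff[OF assms])
  finally show ?thesis .
qed

text \<open>If |x| < 2 sqrt n and the projection of \<open>x\<close> has coordinates at most
  \<open>s\<close>, then \<open>x\<close> lies in the box of half-side 2 s sqrt n, whose probability
  is a power of a one-dimensional one.\<close>

lemma sphere_measure_sup_norm_le_upper:
  assumes n: "0 < n" and s: "0 \<le> s"
  shows "measure (sphere_measure n) {\<theta> \<in> space (sphere_measure n). sup_norm n \<theta> \<le> s}
    \<le> (1 - gauss_tail_const * exp (- 4 * s\<^sup>2 * n)) ^ n + exp (- real n / 2)"
proof -
  interpret prob_space "gauss_n n" by (rule prob_space_gauss_n)
  let ?t = "2 * s * sqrt n"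
  let ?A = "{x \<in> space (gauss_n n). \<forall>i<n. \<bar>x i\<bar> \<le> ?t}" and ?B = "{x \<in> space (gauss_n n). 4 * real n \<le> sq_norm n x}"
  have [measurable]: "?B \<in> sets (gauss_n n)" by measurable
  have [measurable]: "?A \<in> sets (gauss_n n)"
  proof -
    have "?A = {x \<in> space (gauss_n n). \<forall>i\<in>{..<n}. \<bar>x i\<bar> \<le> ?t}" by auto
    also have "\<dots> \<in> sets (gauss_n n)" by measurable
    finally show ?thesis .
  qed
  have "measure (gauss_n n) {x \<in> space (gauss_n n). \<forall>i<n. \<bar>sphere_proj n x i\<bar> \<le> s} \<le> measure (gauss_n n) (?A \<union> ?B)"
  proof (rule finite_measure_mono)
    show "{x \<in> space (gauss_n n). \<forall>i<n. \<bar>sphere_proj n x i\<bar> \<le> s} \<subseteq> ?A \<union> ?B"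
    proof
      fix x assume x: "x \<in> {x \<in> space (gauss_n n). \<forall>i<n. \<bar>sphere_proj n x i\<bar> \<le> s}"
      show "x \<in> ?A \<union> ?B"
      proof (cases "4 * real n \<le> sq_norm n x")
        case False
        have "\<bar>x i\<bar> \<le> ?t" if i: "i < n" for i
        \<comment> \<open>The default value of the projection carries no information about
          \<open>x\<close>, so the origin is treated by itself.\<close>
        proof (cases "sq_norm n x = 0")
          case True
          then have "x i = 0" using i by (auto simp: sq_norm_def sum_nonneg_eq_0_iff)
          then show ?thesis using s by simp
        next
          case nz: False
          then have pos: "0 < sqrt (sq_norm n x)" using sq_norm_nonneg[of n x] by simp
          have "\<bar>x i\<bar> / sqrt (sq_norm n x) \<le> s"
            using x i nz pos by (auto simp: sphere_proj_def)
          then have "\<bar>x i\<bar> \<le> s * sqrt (sq_norm n x)" using pos by (simp add: field_simps)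
          also have "\<dots> \<le> s * sqrt (4 * real n)"
            using s False by (intro mult_left_mono real_sqrt_le_mono) auto
          finally show ?thesis by (simp add: real_sqrt_mult)
        qed
        then show ?thesis using x by simp
      qed (use x in simp)
    qed
  qed measurable
  also have "\<dots> \<le> measure (gauss_n n) ?A + measure (gauss_n n) ?B"
    by (rule measure_Un_le) measurable
  also have "measure (gauss_n n) ?B \<le> exp (- real n / 2)" by (rule gauss_n_sq_norm_large)
  also have "measure (gauss_n n) ?A \<le> (1 - gauss_tail_const * exp (- 4 * s\<^sup>2 * n)) ^ n"
    unfolding gauss_n_box using gauss_1_interval_le[of ?t] s
    by (intro power_mono) (auto simp: power_mult_distrib)
  finally show ?thesis by (simp add: sphere_measure_sup_norm_le_eq[OF n])
qed

text \<open>Square root of the threshold in \<open>gauss_n_sq_norm_small\<close>: |x| exceeds this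
  multiple of sqrt n except with probability exp (-2n).\<close>

definition small_ball_const :: real where
  "small_ball_const = sqrt (2 / (exp 6 - 1))"

lemma small_ball_const_pos: "0 < small_ball_const"
  by (simp add: small_ball_const_def)

text \<open>The converse inclusion: a point of the box whose norm is not too small has a projection
  with small coordinates. The second condition on \<open>t\<close> keeps the base of the power
  nonnegative.\<close>

lemma sphere_measure_sup_norm_le_lower:
  assumes n: "0 < n" and t: "0 \<le> t" "sqrt 2 * exp (- t\<^sup>2 / 4) \<le> 1"
  shows "(1 - sqrt 2 * exp (- t\<^sup>2 / 4)) ^ n - exp (- 2 * real n) \<le>
    measure (sphere_measure n) {\<theta> \<in> space (sphere_measure n). sup_norm n \<theta> \<le> t / (small_ball_const * sqrt n)}"
proof -
  interpret prob_space "gauss_n n" by (rule prob_space_gauss_n)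
  let ?s = "t / (small_ball_const * sqrt n)"
  let ?A = "{x \<in> space (gauss_n n). \<forall>i<n. \<bar>x i\<bar> \<le> t}"
  let ?B = "{x \<in> space (gauss_n n). sq_norm n x \<le> 2 / (exp 6 - 1) * real n}"
  let ?C = "{x \<in> space (gauss_n n). \<forall>i<n. \<bar>sphere_proj n x i\<bar> \<le> ?s}"
  have B: "?B \<in> sets (gauss_n n)" by measurable
  have C: "?C \<in> sets (gauss_n n)"
  proof -
    have "(\<lambda>x. sphere_proj n x i) \<in> borel_measurable (gauss_n n)" if "i \<in> {..<n}" for i
      using measurable_sphere_proj_PiM measurable_component_singleton[OF that] by (rule measurable_compose)
    note [measurable] = this
    have "?C = {x \<in> space (gauss_n n). \<forall>i\<in>{..<n}. \<bar>sphere_proj n x i\<bar> \<le> ?s}" by auto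
    also have "\<dots> \<in> sets (gauss_n n)" by measurable
    finally show ?thesis .
  qed
  have "(1 - sqrt 2 * exp (- t\<^sup>2 / 4)) ^ n \<le> measure std_normal_distribution {- t..t} ^ n"
    using gauss_1_interval_ge[OF t(1)] t(2) by (intro power_mono) auto
  also have "\<dots> = measure (gauss_n n) ?A" by (rule gauss_n_box[symmetric])
  also have "\<dots> \<le> measure (gauss_n n) (?C \<union> ?B)"
  proof (rule finite_measure_mono)
    show "?A \<subseteq> ?C \<union> ?B"
    proof
      fix x assume x: "x \<in> ?A"
      show "x \<in> ?C \<union> ?B"
      proof (cases "sq_norm n x \<le> 2 / (exp 6 - 1) * real n")
        case False
        have "0 < 2 / (exp 6 - 1) * real n" using n by simp
        then have pos: "0 < sq_norm n x" using False by linarith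
        have "small_ball_const * sqrt n = sqrt (2 / (exp 6 - 1) * real n)"
          by (simp only: small_ball_const_def real_sqrt_mult)
        also have "\<dots> \<le> sqrt (sq_norm n x)" using False by simp
        finally have le: "small_ball_const * sqrt n \<le> sqrt (sq_norm n x)" .
        have "\<bar>sphere_proj n x i\<bar> \<le> ?s" if i: "i < n" for i
        proof -
          have "\<bar>sphere_proj n x i\<bar> = \<bar>x i\<bar> / sqrt (sq_norm n x)"
            using i pos by (simp add: sphere_proj_def)
          also have "\<dots> \<le> ?s"
            using x i le n small_ball_const_pos t(1) by (intro frac_le) auto
          finally show ?thesis .
        qed
        then show ?thesis using x by simp
      qed (use x in blast)
    qed
  next
    show "?C \<union> ?B \<in> sets (gauss_n n)" using C B by (rule sets.Un)
  qed
  also have "\<dots> \<le> measure (gauss_n n) ?C + measure (gauss_n n) ?B"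
    using C B by (rule measure_Un_le)
  also have "measure (gauss_n n) ?B \<le> exp (- 2 * real n)" by (rule gauss_n_sq_norm_small)
  finally show ?thesis by (simp add: sphere_measure_sup_norm_le_eq[OF n])
qed

subsection \<open>Moments of the maximum norm\<close>

text \<open>The lower bound controls negative powers on exceptional events; the upper bound does the
  same for the mean of the maximum norm.\<close>

lemma sup_norm_sphere_bounds:
  assumes n: "0 < n" and x: "x \<in> unit_sphere n"
  shows "1 / sqrt n \<le> sup_norm n x" "sup_norm n x \<le> 1"
proof -
  have 1: "(\<Sum>i<n. (x i)\<^sup>2) = 1" using x by (simp add: unit_sphere_iff sq_norm_def)
  have le: "\<bar>x i\<bar> \<le> sup_norm n x" if "i < n" for i
    using sup_norm_le_iff[OF n, of x "sup_norm n x"] that by simp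
  have nonneg: "0 \<le> sup_norm n x" using le[OF n] by simp
  have "1 \<le> (\<Sum>i<n. (sup_norm n x)\<^sup>2)"
    unfolding 1[symmetric]
  proof (rule sum_mono)
    fix i assume "i \<in> {..<n}"
    then show "(x i)\<^sup>2 \<le> (sup_norm n x)\<^sup>2" using power_mono[OF le, of i 2] by simp
  qed
  then have "1 / real n \<le> (sup_norm n x)\<^sup>2" using n by (simp add: field_simps)
  then have "sqrt (1 / real n) \<le> sup_norm n x" using nonneg by (rule real_le_lsqrt[rotated])
  then show "1 / sqrt n \<le> sup_norm n x" by (simp add: real_sqrt_divide)
  have "\<bar>x i\<bar> \<le> 1" if i: "i < n" for i
  proof -
    have "(x i)\<^sup>2 \<le> (\<Sum>i<n. (x i)\<^sup>2)" using i by (intro member_le_sum) auto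
    then show ?thesis unfolding 1 by (simp add: abs_square_le_1)
  qed
  then show "sup_norm n x \<le> 1" by (simp add: sup_norm_le_iff[OF n])
qed

lemma prob_space_sphere_measure: "0 < n \<Longrightarrow> prob_space (sphere_measure n)"
  using rotation_invariant_prob_sphere_measure by (simp add: rotation_invariant_prob_def)

lemma space_sphere_measure: "0 < n \<Longrightarrow> space (sphere_measure n) = unit_sphere n"
  using rotation_invariant_prob_sphere_measure by (simp add: rotation_invariant_prob_def)

lemma sup_norm_sphere_measurable: "0 < n \<Longrightarrow> sup_norm n \<in> borel_measurable (sphere_measure n)"
  using measurable_compose[OF rotation_invariant_prob_measurable_id measurable_sup_norm]
    rotation_invariant_prob_sphere_measure by blast

lemma sup_norm_powr_integrable:
  assumes n: "0 < n"
  shows "integrable (sphere_measure n) (\<lambda>\<theta>. sup_norm n \<theta> powr r)"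
proof -
  interpret prob_space "sphere_measure n" using n by (rule prob_space_sphere_measure)
  note [measurable] = sup_norm_sphere_measurable[OF n]
  have "norm (sup_norm n \<theta> powr r) \<le> max 1 ((1 / sqrt n) powr r)" if "\<theta> \<in> unit_sphere n" for \<theta>
  proof (cases "0 \<le> r")
    case True
    then have "sup_norm n \<theta> powr r \<le> 1 powr r"
      using sup_norm_sphere_bounds[OF n that] n
      by (intro powr_mono2) (auto intro: order_trans[of 0 "1 / sqrt (real n)"])
    then show ?thesis by simp
  next
    case False
    then have "sup_norm n \<theta> powr r \<le> (1 / sqrt n) powr r"
      using sup_norm_sphere_bounds[OF n that] n by (intro powr_mono2') auto
    then show ?thesis by simp
  qed
  then have "AE \<theta> in sphere_measure n. norm (sup_norm n \<theta> powr r) \<le> max 1 ((1 / sqrt n) powr r)"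
    by (intro AE_I2) (simp add: space_sphere_measure[OF n])
  then show ?thesis by (intro integrable_const_bound) auto
qed

lemma sup_norm_sphere_pos: "0 < n \<Longrightarrow> x \<in> unit_sphere n \<Longrightarrow> 0 < sup_norm n x"
  using sup_norm_sphere_bounds(1)[of n x] by (rule less_le_trans[rotated]) auto

text \<open>In \<open>M_neg_cube_ge\<close> the power \<open>- 1 / p\<close> reverses an inequality,
  and for this the moment must be known to be positive.\<close>

lemma sup_norm_moment_ge_1:
  assumes n: "0 < n" and p: "0 < p"
  shows "1 \<le> (\<integral>\<theta>. sup_norm n \<theta> powr (- p) \<partial>sphere_measure n)"
proof -
  interpret prob_space "sphere_measure n" using n by (rule prob_space_sphere_measure)
  have "(\<integral>\<theta>. 1 \<partial>sphere_measure n) \<le> (\<integral>\<theta>. sup_norm n \<theta> powr (- p) \<partial>sphere_measure n)"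
  proof (intro integral_mono sup_norm_powr_integrable n)
    fix \<theta> assume "\<theta> \<in> space (sphere_measure n)"
    then have \<theta>: "\<theta> \<in> unit_sphere n" by (simp add: space_sphere_measure[OF n])
    have "1 powr (- p) \<le> sup_norm n \<theta> powr (- p)"
      using p sup_norm_sphere_pos[OF n \<theta>] sup_norm_sphere_bounds[OF n \<theta>] by (intro powr_mono2') auto
    then show "1 \<le> sup_norm n \<theta> powr (- p)" by simp
  qed simp
  then show ?thesis by (simp add: prob_space)
qed

lemma M_neg_cube_ge:
  assumes "0 < n" "0 < p" "0 < A" and le: "(\<integral>\<theta>. sup_norm n \<theta> powr (- p) \<partial>sphere_measure n) \<le> A powr (- p)"
  shows "A \<le> M_neg_cube n p"
proof -
  have "(A powr (- p)) powr (- 1 / p) \<le> M_neg_cube n p"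
    unfolding M_neg_cube_def using sup_norm_moment_ge_1[OF assms(1,2)] le \<open>0 < p\<close>
    by (intro powr_mono2') auto
  then show ?thesis using assms by (simp add: powr_powr)
qed

lemma M_neg_cube_le:
  assumes "0 < n" "0 < p" "0 < A" and le: "A powr (- p) \<le> (\<integral>\<theta>. sup_norm n \<theta> powr (- p) \<partial>sphere_measure n)"
  shows "M_neg_cube n p \<le> A"
proof -
  have "M_neg_cube n p \<le> (A powr (- p)) powr (- 1 / p)"
    unfolding M_neg_cube_def using le assms by (intro powr_mono2') auto
  then show ?thesis using assms by (simp add: powr_powr)
qed

lemma sqrt_powr: "0 \<le> x \<Longrightarrow> sqrt x powr r = x powr (r / 2)"
  by (simp add: powr_half_sqrt[symmetric] powr_powr)

section \<open>The logarithmic factor\<close>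

definition log_term :: "nat \<Rightarrow> real \<Rightarrow> real" where
  "log_term n p = ln (exp 1 + real n / (1 + p))"

lemma exp_1_ge_2: "(2::real) \<le> exp 1"
  using exp_ge_add_one_self[of "1::real"] by simp

text \<open>With u = n / (1 + p), the second bound is e + u <= e (1 + u) <= exp (1 + u); it gives p
  ln L <= n, against which exp (-n/2) is measured.\<close>

lemma log_term_bounds:
  assumes p: "0 < p"
  shows "1 \<le> log_term n p" "log_term n p \<le> 1 + real n / (1 + p)"
    "exp (log_term n p) = exp 1 + real n / (1 + p)"
proof -
  have pos: "0 \<le> real n / (1 + p)" using p by simp
  have pos': "0 < exp 1 + real n / (1 + p)" using pos by (smt (verit) exp_gt_zero)
  show e: "exp (log_term n p) = exp 1 + real n / (1 + p)"
    using pos' by (simp add: log_term_def)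
  show "1 \<le> log_term n p"
    using e pos exp_le_cancel_iff[of 1 "log_term n p"] by linarith
  have "exp 1 + real n / (1 + p) \<le> exp 1 * (1 + real n / (1 + p))"
    using pos exp_1_ge_2 mult_right_mono[of 1 "exp 1" "real n / (1 + p)"] by (simp add: distrib_left)
  also have "\<dots> \<le> exp 1 * exp (real n / (1 + p))"
    using exp_ge_add_one_self[of "real n / (1 + p)"] by (intro mult_left_mono) auto
  finally have "exp (log_term n p) \<le> exp (1 + real n / (1 + p))"
    unfolding e exp_add .
  then show "log_term n p \<le> 1 + real n / (1 + p)" by simp
qed

section \<open>Upper bounds for the negative moments\<close>

lemma gauss_tail_const_bounds: "0 < gauss_tail_const" "gauss_tail_const \<le> 1 / 2"
proof -
  show "0 < gauss_tail_const" by (simp add: gauss_tail_const_def)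
  have "1 \<le> sqrt (2 * pi)" using pi_gt3 by simp
  then have "1 * 2 \<le> sqrt (2 * pi) * exp 1" using exp_1_ge_2 by (intro mult_mono) auto
  then show "gauss_tail_const \<le> 1 / 2"
    unfolding gauss_tail_const_def by (intro divide_left_mono) auto
qed

text \<open>The logarithmic form of exp (-n q exp (-L/2)) <= (4 / (q L))^(p/2), where exp (L/2) is
  the square root on the right. With u = n / (1 + p) the right side is of order (1 + p) q sqrt u
  when u >= 1, and L is at most of order sqrt u.\<close>

lemma box_term_bound:
  assumes p: "0 < p" and q: "0 < q" "q \<le> 1 / 2"
  shows "p / 2 * ln (log_term n p * q / 4) \<le> real n * q / sqrt (exp 1 + real n / (1 + p))"
proof -
  define L where "L = log_term n p"
  define u where "u = real n / (1 + p)"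
  have u0: "0 \<le> u" using p by (simp add: u_def)
  have n: "real n = (1 + p) * u" using p by (simp add: u_def)
  have L1: "1 \<le> L" and eL: "exp L = exp 1 + u"
    using log_term_bounds[OF p, of n] by (auto simp: L_def u_def)
  have rhs0: "0 \<le> real n * q / sqrt (exp 1 + u)" using q u0 by simp
  show ?thesis
    unfolding L_def[symmetric] u_def[symmetric]
  proof (cases "L * q / 4 \<le> 1")
    case True
    then have "ln (L * q / 4) \<le> 0" using L1 q by (subst ln_le_zero_iff) auto
    then have "p / 2 * ln (L * q / 4) \<le> 0" using p by (simp add: mult_le_0_iff)
    then show "p / 2 * ln (L * q / 4) \<le> real n * q / sqrt (exp 1 + u)" using rhs0 by linarith
  next
    case False
    \<comment> \<open>As q <= 1/2, a nontrivial left side forces L > 8. Then u >= 1, and e + u may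
      be replaced by 4 u.\<close>
    have "L * q \<le> L * (1 / 2)" using q L1 by (intro mult_left_mono) auto
    then have "8 \<le> L" using False by linarith
    then have "1 + 8 \<le> exp L" using exp_ge_add_one_self[of L] by linarith
    then have u: "1 \<le> u" using eL exp_le by linarith
    have s: "sqrt (exp 1 + u) \<le> 2 * sqrt u"
    proof -
      have "sqrt (exp 1 + u) \<le> sqrt (4 * u)" using u exp_le by (intro real_sqrt_le_mono) linarith
      then show ?thesis by (simp add: real_sqrt_mult)
    qed
    have su: "1 \<le> sqrt u" using u by simp
    have spos: "0 < sqrt (exp 1 + u)" using u0 by (smt (verit) exp_gt_zero real_sqrt_gt_0_iff)
    have "L \<le> 4 * sqrt u"
    proof -
      have "exp L \<le> (2 * sqrt u)\<^sup>2"
        using u exp_le by (simp add: eL power_mult_distrib)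
      also have "\<dots> \<le> (exp (2 * sqrt u))\<^sup>2"
        using exp_ge_add_one_self[of "2 * sqrt u"] su by (intro power_mono) linarith+
      also have "\<dots> = exp (4 * sqrt u)" by (simp add: power2_eq_square exp_add[symmetric])
      finally show ?thesis by simp
    qed
    then have Lq: "L * q / 4 \<le> sqrt u * q" using q by simp
    have "ln (L * q / 4) \<le> L * q / 4 - 1" using False by (intro ln_le_minus_one) auto
    then have l: "ln (L * q / 4) \<le> sqrt u * q" using Lq by linarith
    have l0: "0 \<le> ln (L * q / 4)" using False by (intro ln_ge_zero) auto
    have "p / 2 * ln (L * q / 4) \<le> (1 + p) / 2 * (sqrt u * q)"
      using l l0 p by (intro mult_mono) auto
    also have "\<dots> = real n * q / (2 * sqrt u)"
    proof -
      define w where "w = sqrt u"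
      have w: "0 < w" "real n = (1 + p) * (w * w)" using u u0 by (auto simp: w_def n)
      show ?thesis unfolding w_def[symmetric] w(2) using w(1) by simp
    qed
    also have "\<dots> \<le> real n * q / sqrt (exp 1 + u)"
      using s spos q by (intro frac_le) auto
    finally show "p / 2 * ln (L * q / 4) \<le> real n * q / sqrt (exp 1 + u)" .
  qed
qed

text \<open>The integral is split at the level \<open>s\<close>: above it the integrand is at most
  \<open>s powr (- p)\<close>, below it at most n^(p/2), and \<open>P\<close> makes the second part
  no larger than a constant to the power p times the first.\<close>

lemma sup_norm_moment_upper_ge_1:
  assumes n: "0 < n" and p: "1 \<le> p"
  shows "(\<integral>\<theta>. sup_norm n \<theta> powr (- p) \<partial>sphere_measure n)
    \<le> (36 / gauss_tail_const * n / log_term n p) powr (p / 2)"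
proof -
  interpret prob_space "sphere_measure n" using n by (rule prob_space_sphere_measure)
  note [measurable] = sup_norm_sphere_measurable[OF n]
  define q where "q = gauss_tail_const"
  have q: "0 < q" "q \<le> 1 / 2" using gauss_tail_const_bounds by (auto simp: q_def)
  define L where "L = log_term n p"
  have L1: "1 \<le> L" and Lle: "L \<le> 1 + real n / (1 + p)" and eL: "exp L = exp 1 + real n / (1 + p)"
    using log_term_bounds[of p n] p by (auto simp: L_def)
  \<comment> \<open>The 8 makes 4 s^2 n = L/2, so a single coordinate leaves the box with
    probability at least of order (e + n/(1+p))^(-1/2). This is what \<open>box_term_bound\<close>
    needs.\<close>
  define s where "s = sqrt (L / (8 * n))"
  have s: "0 < s" "s\<^sup>2 = L / (8 * n)" using n L1 by (auto simp: s_def)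
  define A where "A = {\<theta> \<in> space (sphere_measure n). sup_norm n \<theta> \<le> s}"
  let ?P = "measure (sphere_measure n) A"
  have [measurable]: "A \<in> sets (sphere_measure n)" unfolding A_def by measurable
  have sp: "s powr (- p) = (8 * n / L) powr (p / 2)"
  proof -
    have "s powr (- p) = (L / (8 * n)) powr (- (p / 2))"
      unfolding s_def using L1 by (simp add: sqrt_powr)
    also have "\<dots> = (8 * n / L) powr (p / 2)"
      using n L1 by (simp add: powr_minus_divide powr_divide)
    finally show ?thesis .
  qed
  have np: "(1 / sqrt n) powr (- p) = n powr (p / 2)"
  proof -
    have "(1 / sqrt n) powr (- p) = sqrt n powr p"
      using n by (simp add: powr_minus_divide powr_divide)
    also have "\<dots> = n powr (p / 2)" by (simp add: sqrt_powr)
    finally show ?thesis .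
  qed
  have P: "?P \<le> (4 / q / L) powr (p / 2) + (1 / L) powr (p / 2)"
  proof -
    have "?P \<le> (1 - q * exp (- 4 * s\<^sup>2 * n)) ^ n + exp (- real n / 2)"
      unfolding q_def A_def using n s by (intro sphere_measure_sup_norm_le_upper) auto
    \<comment> \<open>The norm error is affordable because p ln L <= p (L - 1) <= p n / (1 + p) <=
      n.\<close>
    also have "exp (- real n / 2) \<le> (1 / L) powr (p / 2)"
    proof -
      have "p * ln L \<le> p * (real n / (1 + p))"
        using ln_le_minus_one[of L] L1 Lle p by (intro mult_left_mono) auto
      also have "\<dots> \<le> real n" using p by (simp add: field_simps)
      finally show ?thesis using L1 by (simp add: powr_def ln_div)
    qed
    also have "(1 - q * exp (- 4 * s\<^sup>2 * n)) ^ n \<le> (4 / q / L) powr (p / 2)"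
    proof -
      have "4 * s\<^sup>2 * n = L / 2" using n by (simp add: s(2))
      then have e: "exp (- 4 * s\<^sup>2 * n) = exp (- (L / 2))" by simp
      have e': "exp (- (L / 2)) = 1 / sqrt (exp 1 + real n / (1 + p))"
      proof -
        have "sqrt (exp L) = sqrt ((exp (L / 2))\<^sup>2)" by (simp add: power2_eq_square exp_add[symmetric])
        then have "sqrt (exp 1 + real n / (1 + p)) = exp (L / 2)" by (simp add: eL)
        then show ?thesis by (simp add: exp_minus inverse_eq_divide)
      qed
      have "q * exp (- (L / 2)) \<le> 1 * 1" using q L1 by (intro mult_mono) auto
      then have "(1 - q * exp (- (L / 2))) ^ n \<le> exp (- (q * exp (- (L / 2)))) ^ n"
        using exp_ge_add_one_self[of "- (q * exp (- (L / 2)))"] by (intro power_mono) auto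
      also have "\<dots> = exp (- (real n * q / sqrt (exp 1 + real n / (1 + p))))"
        by (simp add: exp_of_nat_mult[symmetric] e')
      also have "\<dots> \<le> exp (- (p / 2 * ln (L * q / 4)))"
        using box_term_bound[OF _ q, of p n] p by (simp add: L_def)
      also have "\<dots> = (4 / q / L) powr (p / 2)"
        using L1 q by (simp add: powr_def ln_div ln_mult algebra_simps)
      finally show ?thesis unfolding e .
    qed
    finally show ?thesis by simp
  qed
  have "(\<integral>\<theta>. sup_norm n \<theta> powr (- p) \<partial>sphere_measure n) \<le>
    (\<integral>\<theta>. s powr (- p) + n powr (p / 2) * indicator A \<theta> \<partial>sphere_measure n)"
  proof (intro integral_mono sup_norm_powr_integrable n)
    fix \<theta> assume \<theta>': "\<theta> \<in> space (sphere_measure n)"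
    then have \<theta>: "\<theta> \<in> unit_sphere n" by (simp add: space_sphere_measure[OF n])
    show "sup_norm n \<theta> powr (- p) \<le> s powr (- p) + n powr (p / 2) * indicator A \<theta>"
    proof (cases "sup_norm n \<theta> \<le> s")
      case True
      have "sup_norm n \<theta> powr (- p) \<le> (1 / sqrt n) powr (- p)"
        using sup_norm_sphere_bounds[OF n \<theta>] n p by (intro powr_mono2') auto
      then show ?thesis using True \<theta>' unfolding A_def np by (simp add: add_increasing)
    next
      case False
      then have "sup_norm n \<theta> powr (- p) \<le> s powr (- p)"
        using s p by (intro powr_mono2') auto
      then show ?thesis using False by (simp add: A_def)
    qed
  qed (auto intro!: integrable_mult_right integrable_real_indicator simp: emeasure_eq_measure)
  also have "\<dots> = s powr (- p) + n powr (p / 2) * ?P"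
    by (subst Bochner_Integration.integral_add) (auto simp: prob_space emeasure_eq_measure)
  also have "\<dots> \<le> s powr (- p) + n powr (p / 2) * ((4 / q / L) powr (p / 2) + (1 / L) powr (p / 2))"
    using P by (intro add_left_mono mult_left_mono) auto
  also have "s powr (- p) + n powr (p / 2) * ((4 / q / L) powr (p / 2) + (1 / L) powr (p / 2)) =
    (8 * n / L) powr (p / 2) + (4 / q * n / L) powr (p / 2) + (n / L) powr (p / 2)"
    using q L1 n by (simp add: sp distrib_left powr_mult[symmetric] mult_ac)
  also have "\<dots> \<le> 3 * (4 / q * n / L) powr (p / 2)"
  proof -
    have "8 \<le> 4 / q" using q by (simp add: field_simps)
    then have le: "r * n / L \<le> 4 / q * n / L" if "r \<le> 8" for r :: real
      using L1 that by (intro divide_right_mono mult_right_mono) auto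
    have "8 * n / L \<le> 4 / q * n / L" "n / L \<le> 4 / q * n / L"
      using le[of 8] le[of 1] by simp_all
    then have "(8 * n / L) powr (p / 2) \<le> (4 / q * n / L) powr (p / 2)" "(n / L) powr (p / 2) \<le> (4 / q * n / L) powr (p / 2)"
      using p L1 by (auto intro!: powr_mono2)
    then show ?thesis by linarith
  qed
  \<comment> \<open>The factor 3 counts the summands. For p >= 1 it is at most 9^(p/2) and is
    absorbed into the base, whence 36 = 9 * 4.\<close>
  also have "\<dots> \<le> 9 powr (p / 2) * (4 / q * n / L) powr (p / 2)"
  proof (intro mult_right_mono)
    have "9 powr (1 / 2) \<le> (9::real) powr (p / 2)" using p by (intro powr_mono) auto
    moreover have "9 powr (1 / 2) = (3::real)" by (simp add: powr_half_sqrt real_sqrt_unique)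
    ultimately show "3 \<le> (9::real) powr (p / 2)" by simp
  qed simp
  also have "\<dots> = (36 / q * n / L) powr (p / 2)"
    unfolding powr_mult[symmetric] by simp
  finally show ?thesis by (simp add: q_def L_def)
qed

text \<open>The graph of a concave power lies below its tangent at 1; the inequality is read off
  from the convexity of exp between 0 and \<open>ln y\<close>.\<close>

lemma powr_le_tangent:
  assumes "0 < y" "0 < p" "p \<le> (1::real)"
  shows "y powr p \<le> 1 + p * (y - 1)"
proof -
  have "exp ((1 - p) *\<^sub>R 0 + p *\<^sub>R ln y) \<le> (1 - p) * exp 0 + p * exp (ln y)"
    using exp_convex assms by (intro convex_onD) auto
  then show ?thesis using assms by (simp add: powr_def algebra_simps)
qed

text \<open>For p in (0, 1] the term lies between its value at p = 1 and its limit ln (e + n) at p =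
  0. These differ at most by a factor 2, since e + n <= (e + n/2)^2.\<close>

lemma log_term_le_double:
  assumes "0 < p" "p \<le> 1"
  shows "log_term n p \<le> 2 * log_term n 1" "ln (exp 1 + n) \<le> 2 * log_term n p"
proof -
  have pos: "0 < exp 1 + real n" by (smt (verit) exp_gt_zero of_nat_0_le_iff)
  have 1: "ln (exp 1 + real n) \<le> 2 * log_term n 1"
  proof -
    have "exp (ln (exp 1 + real n)) = exp 1 + real n" using pos by simp
    also have "\<dots> \<le> (exp 1 + real n / 2)\<^sup>2"
    proof -
      have "1 * exp 1 \<le> exp 1 * exp (1::real)" "1 * real n \<le> exp 1 * real n"
        using exp_1_ge_2 by (intro mult_right_mono; simp)+
      moreover have "0 \<le> real n * real n / 4" by simp
      moreover have "(exp 1 + real n / 2)\<^sup>2 = exp 1 * exp 1 + exp 1 * real n + real n * real n / 4"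
        by (simp add: power2_eq_square field_simps)
      ultimately show ?thesis by linarith
    qed
    also have "\<dots> = exp (2 * log_term n 1)"
      using log_term_bounds(3)[of 1 n] by (simp add: exp_double)
    finally show ?thesis by simp
  qed
  have mono: "log_term n r \<le> log_term n r'" if "0 < r'" "r' \<le> r" for r r'
  proof -
    have "exp (log_term n r) \<le> exp (log_term n r')"
      using that by (simp add: log_term_bounds(3) frac_le)
    then show ?thesis by simp
  qed
  have "exp (log_term n p) \<le> exp (ln (exp 1 + real n))"
    using assms pos by (simp add: log_term_bounds(3) divide_le_eq mult_left_le mult_le_cancel_left1)
  then have "log_term n p \<le> ln (exp 1 + real n)" by simp
  with 1 show "log_term n p \<le> 2 * log_term n 1" by linarith
  show "ln (exp 1 + n) \<le> 2 * log_term n p" using 1 mono[of p 1] assms by linarith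
qed

lemma (in prob_space) expectation_affine:
  fixes f :: "'a \<Rightarrow> real"
  assumes "integrable M f"
  shows "expectation (\<lambda>x. a * (1 + p * (f x / D - 1))) = a * (1 + p * (expectation f / D - 1))"
  using assms by (simp add: prob_space)

lemma sup_norm_moment_upper:
  assumes n: "0 < n" and p: "0 < p"
  shows "(\<integral>\<theta>. sup_norm n \<theta> powr (- p) \<partial>sphere_measure n)
    \<le> (72 / gauss_tail_const * n / log_term n p) powr (p / 2)"
proof -
  let ?q = "gauss_tail_const"
  have q: "0 < ?q" by (rule gauss_tail_const_bounds)
  have L1: "1 \<le> log_term n p" "1 \<le> log_term n 1" using log_term_bounds(1) p by auto
  show ?thesis
  proof (cases "1 \<le> p")
    case True
    have "(36 / ?q * n / log_term n p) powr (p / 2) \<le> (72 / ?q * n / log_term n p) powr (p / 2)"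
      using q L1 p by (intro powr_mono2 divide_right_mono mult_right_mono) auto
    then show ?thesis using sup_norm_moment_upper_ge_1[OF n True] by linarith
  next
    case False
    interpret prob_space "sphere_measure n" using n by (rule prob_space_sphere_measure)
    define D where "D = (36 / ?q * n / log_term n 1) powr (1 / 2)"
    have D: "0 < D" using q L1 n by (simp add: D_def)
    have I1: "(\<integral>\<theta>. sup_norm n \<theta> powr (- 1) \<partial>sphere_measure n) \<le> D"
      unfolding D_def by (rule sup_norm_moment_upper_ge_1[OF n]) simp
    have int: "integrable (sphere_measure n) (\<lambda>\<theta>. sup_norm n \<theta> powr r)" for r
      using n by (rule sup_norm_powr_integrable)
    \<comment> \<open>X^(-p) is the p-th power of 1/X. The tangent is taken at the bound
      \<open>D\<close> for the mean of 1/X, not at the mean itself, so that the linear term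
      integrates to something nonpositive and D^p remains with no extra factor.\<close>
    have "(\<integral>\<theta>. sup_norm n \<theta> powr (- p) \<partial>sphere_measure n) \<le>
      (\<integral>\<theta>. D powr p * (1 + p * (sup_norm n \<theta> powr (- 1) / D - 1)) \<partial>sphere_measure n)"
    proof (intro integral_mono int)
      fix \<theta> assume "\<theta> \<in> space (sphere_measure n)"
      then have pos: "0 < sup_norm n \<theta>" using sup_norm_sphere_pos[OF n] by (simp add: space_sphere_measure[OF n])
      have "sup_norm n \<theta> powr (- p) = D powr p * (sup_norm n \<theta> powr (- 1) / D) powr p"
      proof -
        have "(sup_norm n \<theta> powr (- 1) / D) powr p = (sup_norm n \<theta> powr (- 1)) powr p / D powr p"
          by (rule powr_divide)
        also have "(sup_norm n \<theta> powr (- 1)) powr p = sup_norm n \<theta> powr (- p)"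
          unfolding powr_powr by simp
        finally show ?thesis using D by simp
      qed
      also have "\<dots> \<le> D powr p * (1 + p * (sup_norm n \<theta> powr (- 1) / D - 1))"
        using pos D p False by (intro mult_left_mono powr_le_tangent) auto
      finally show "sup_norm n \<theta> powr (- p) \<le> D powr p * (1 + p * (sup_norm n \<theta> powr (- 1) / D - 1))" .
    qed (intro integrable_mult_right Bochner_Integration.integrable_add Bochner_Integration.integrable_diff integrable_divide int integrable_const)
    also have "\<dots> = D powr p * (1 + p * ((\<integral>\<theta>. sup_norm n \<theta> powr (- 1) \<partial>sphere_measure n) / D - 1))"
      by (rule expectation_affine[OF int])
    also have "\<dots> \<le> D powr p * 1"
    proof (intro mult_left_mono)
      have "(\<integral>\<theta>. sup_norm n \<theta> powr (- 1) \<partial>sphere_measure n) / D - 1 \<le> 0"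
        using I1 D by simp
      then show "1 + p * ((\<integral>\<theta>. sup_norm n \<theta> powr (- 1) \<partial>sphere_measure n) / D - 1) \<le> 1"
        using p by (simp add: mult_le_0_iff)
    qed simp
    also have "D powr p * 1 = (36 / ?q * n / log_term n 1) powr (p / 2)"
      by (simp add: D_def powr_powr)
    \<comment> \<open>Passing from \<open>log_term n 1\<close> to \<open>log_term n p\<close> costs
      the factor 2 that turns 36 into 72.\<close>
    also have "\<dots> \<le> (72 / ?q * n / log_term n p) powr (p / 2)"
    proof (intro powr_mono2)
      have "72 / ?q * n / (2 * log_term n 1) \<le> 72 / ?q * n / log_term n p"
        using log_term_le_double(1)[of p n] p False L1 q by (intro divide_left_mono) auto
      then show "36 / ?q * n / log_term n 1 \<le> 72 / ?q * n / log_term n p" by simp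
    qed (use p q L1 in auto)
    finally show ?thesis .
  qed
qed

section \<open>Lower bounds for the negative moments\<close>

lemma one_minus_power_ge:
  fixes x :: real
  assumes "0 \<le> x" "x \<le> 1 / 2"
  shows "exp (- 2 * x * real n) \<le> (1 - x) ^ n"
proof -
  have "x * x \<le> x * (1 / 2)" using assms by (intro mult_left_mono) auto
  then have "- 2 * x \<le> ln (1 - x)"
    using ln_one_minus_pos_lower_bound[of x] assms by (simp add: power2_eq_square)
  then have "exp (- 2 * x) \<le> 1 - x" using assms by (subst ln_ge_iff[symmetric]) auto
  then have "exp (- 2 * x) ^ n \<le> (1 - x) ^ n" by (intro power_mono) auto
  then show ?thesis by (simp add: exp_of_nat_mult[symmetric] mult_ac)
qed

text \<open>The box has half-side t = sqrt (8 L), so that exp (-t^2/4) = exp (-2L). For the moments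
  the surplus exp (-L) only swallows sqrt 2; for the mean the full exponent is needed.
  \<open>L\<close> stays free because it is used both as \<open>log_term n p\<close> and as ln (e +
  n).\<close>

lemma sup_norm_small_ball_lower:
  assumes n: "0 < n" and L: "1 \<le> L"
  shows "(1 - sqrt 2 * exp (- 2 * L)) ^ n - exp (- 2 * real n) \<le>
    measure (sphere_measure n) {\<theta> \<in> space (sphere_measure n). sup_norm n \<theta> \<le> sqrt 8 / small_ball_const * sqrt (L / n)}"
    and "sqrt 2 * exp (- 2 * L) \<le> exp (- L)"
proof -
  have "sqrt 2 \<le> 2" by (rule real_le_lsqrt) auto
  also have "\<dots> \<le> exp L" using exp_ge_add_one_self[of L] L by linarith
  finally have "sqrt 2 * exp (- 2 * L) \<le> exp L * exp (- 2 * L)" by (intro mult_right_mono) auto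
  then show le: "sqrt 2 * exp (- 2 * L) \<le> exp (- L)" by (simp add: exp_add[symmetric])
  then have "sqrt 2 * exp (- 2 * L) \<le> 1" using L by (smt (verit) exp_le_one_iff)
  moreover have "- (sqrt (8 * L))\<^sup>2 / 4 = - 2 * L" using L by simp
  moreover have "sqrt (8 * L) / (small_ball_const * sqrt n) = sqrt 8 / small_ball_const * sqrt (L / n)"
    by (simp add: real_sqrt_mult real_sqrt_divide)
  ultimately show "(1 - sqrt 2 * exp (- 2 * L)) ^ n - exp (- 2 * real n) \<le>
    measure (sphere_measure n) {\<theta> \<in> space (sphere_measure n). sup_norm n \<theta> \<le> sqrt 8 / small_ball_const * sqrt (L / n)}"
    using sphere_measure_sup_norm_le_lower[OF n, of "sqrt (8 * L)"] L by simp
qed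

text \<open>The event X <= s alone contributes s^(-p) times its probability; a probability of at
  least exp (-5p) merely enlarges \<open>s\<close> by the factor exp 5.\<close>

lemma sup_norm_moment_lower_ge_1:
  assumes n: "0 < n" and p: "1 \<le> p"
  shows "(exp 5 * sqrt 8 / small_ball_const * sqrt (log_term n p / n)) powr (- p)
    \<le> (\<integral>\<theta>. sup_norm n \<theta> powr (- p) \<partial>sphere_measure n)"
proof -
  interpret prob_space "sphere_measure n" using n by (rule prob_space_sphere_measure)
  note [measurable] = sup_norm_sphere_measurable[OF n]
  define L where "L = log_term n p"
  define x where "x = exp (- L)"
  have L1: "1 \<le> L" and eL: "exp L = exp 1 + real n / (1 + p)"
    using log_term_bounds[of p n] p by (auto simp: L_def)
  define s where "s = sqrt 8 / small_ball_const * sqrt (L / n)"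
  have s: "0 < s" using small_ball_const_pos L1 n by (simp add: s_def)
  define A where "A = {\<theta> \<in> space (sphere_measure n). sup_norm n \<theta> \<le> s}"
  have [measurable]: "A \<in> sets (sphere_measure n)" unfolding A_def by measurable
  have x2: "x \<le> 1 / 2"
  proof -
    have "x \<le> exp (- 1)" using L1 by (simp add: x_def)
    also have "\<dots> \<le> 1 / 2" using exp_1_ge_2 by (simp add: exp_minus inverse_eq_divide divide_left_mono)
    finally show ?thesis .
  qed
  have x0: "0 < x" by (simp add: x_def)
  define E where "E = exp (- 2 * x * real n)"
  have "E \<le> (1 - x) ^ n" unfolding E_def using x0 x2 by (intro one_minus_power_ge) auto
  also have "\<dots> \<le> (1 - sqrt 2 * exp (- 2 * L)) ^ n"
    using sup_norm_small_ball_lower(2)[OF n L1] x2 by (intro power_mono) (auto simp: x_def simp del: exp_le_one_iff)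
  finally have P1: "E - exp (- 2 * real n) \<le> measure (sphere_measure n) A"
    using sup_norm_small_ball_lower(1)[OF n L1] unfolding A_def s_def by linarith
  have xn: "2 * x * real n \<le> real n" using x2 mult_right_mono[of "2 * x" 1 "real n"] by simp
  \<comment> \<open>Since x <= 1/2, \<open>E\<close> is at least exp (-n), so the norm error exp
    (-2n) takes away at most half of it.\<close>
  have "exp (- 2 * real n) \<le> exp (- 1) * E"
  proof -
    have "1 \<le> real n" using n by simp
    then have "- 2 * real n \<le> - 1 + - 2 * x * real n" using xn by linarith
    then show ?thesis unfolding E_def exp_add[symmetric] by simp
  qed
  also have "\<dots> \<le> (1 / 2) * E"
    using exp_1_ge_2 by (intro mult_right_mono) (auto simp: E_def exp_minus inverse_eq_divide divide_left_mono)
  finally have P2: "exp (- 2 * real n) \<le> E / 2" by simp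
  have "exp (- 5 * p) \<le> E / 2"
  proof -
    \<comment> \<open>x n = n / (e + n/(1+p)) <= 1 + p <= 2 p, so \<open>E\<close> is at least exp
      (-4p). The lost half costs at most another factor exp (-1), hence at most exp (-p).\<close>
    have "x * real n = real n / (exp 1 + real n / (1 + p))"
      by (simp add: x_def exp_minus eL inverse_eq_divide)
    also have "\<dots> \<le> real n / (real n / (1 + p))"
    proof -
      have "0 < real n / (1 + p)" using n p by simp
      moreover from this have "real n / (1 + p) \<le> exp 1 + real n / (1 + p)" by simp
      ultimately show ?thesis by (intro frac_le) auto
    qed
    also have "\<dots> \<le> 2 * p" using n p by simp
    finally have "- 5 * p \<le> - 1 + - 2 * x * real n" using p by simp
    then have "exp (- 5 * p) \<le> exp (- 1) * E" unfolding E_def exp_add[symmetric] by simp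
    also have "\<dots> \<le> (1 / 2) * E"
      using exp_1_ge_2 by (intro mult_right_mono) (auto simp: E_def exp_minus inverse_eq_divide divide_left_mono)
    finally show ?thesis by simp
  qed
  then have P: "exp (- 5 * p) \<le> measure (sphere_measure n) A" using P1 P2 by linarith
  have "(exp 5 * s) powr (- p) = s powr (- p) * exp (- 5 * p)"
    using s by (simp add: powr_mult powr_def[of "exp 5"] mult_ac)
  also have "\<dots> \<le> s powr (- p) * measure (sphere_measure n) A"
    using P by (intro mult_left_mono) auto
  also have "\<dots> = (\<integral>\<theta>. s powr (- p) * indicator A \<theta> \<partial>sphere_measure n)"
    by simp
  also have "\<dots> \<le> (\<integral>\<theta>. sup_norm n \<theta> powr (- p) \<partial>sphere_measure n)"
  proof (intro integral_mono sup_norm_powr_integrable n)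
    fix \<theta> assume "\<theta> \<in> space (sphere_measure n)"
    then have pos: "0 < sup_norm n \<theta>" using sup_norm_sphere_pos[OF n] by (simp add: space_sphere_measure[OF n])
    show "s powr (- p) * indicator A \<theta> \<le> sup_norm n \<theta> powr (- p)"
      using pos p by (auto simp: indicator_def A_def intro!: powr_mono2')
  qed (auto intro!: integrable_mult_right integrable_real_indicator simp: emeasure_eq_measure)
  finally show ?thesis by (simp add: s_def L_def mult.assoc)
qed

text \<open>As X <= 1, its mean is at most s + P(X > s). With L = ln (e + n) that probability is
  O(1/n), which sqrt (L/n) dominates.\<close>

lemma sup_norm_expectation_le:
  assumes n: "0 < n"
  shows "(\<integral>\<theta>. sup_norm n \<theta> \<partial>sphere_measure n) \<le> (sqrt 8 / small_ball_const + 3) * sqrt (ln (exp 1 + n) / n)"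
proof -
  interpret prob_space "sphere_measure n" using n by (rule prob_space_sphere_measure)
  note [measurable] = sup_norm_sphere_measurable[OF n]
  define L where "L = ln (exp 1 + real n)"
  have eL: "exp L = exp 1 + real n" unfolding L_def by (subst exp_ln) (auto intro: add_pos_nonneg)
  have L1: "1 \<le> L"
    using eL exp_le_cancel_iff[of 1 L] by linarith
  define s where "s = sqrt 8 / small_ball_const * sqrt (L / n)"
  have s: "0 < s" using small_ball_const_pos L1 n by (simp add: s_def)
  define x where "x = sqrt 2 * exp (- 2 * L)"
  define A where "A = {\<theta> \<in> space (sphere_measure n). sup_norm n \<theta> \<le> s}"
  have [measurable]: "A \<in> sets (sphere_measure n)" unfolding A_def by measurable
  have x1: "x \<le> 1" using sup_norm_small_ball_lower(2)[OF n L1] L1 unfolding x_def by (smt (verit) exp_le_one_iff)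
  \<comment> \<open>Bernoulli's inequality is sharp enough because x <= 2/n^2: the exponent is -2L
    and exp L exceeds n.\<close>
  have "1 - real n * x \<le> (1 - x) ^ n"
    using Bernoulli_inequality[of "- x" n] x1 by simp
  moreover have "real n * x \<le> 2 / n"
  proof -
    have "exp (- 2 * L) = 1 / (exp L)\<^sup>2"
      by (simp add: power2_eq_square exp_add[symmetric] exp_minus inverse_eq_divide)
    also have "\<dots> \<le> 1 / (real n)\<^sup>2"
    proof -
      have "0 < exp 1 + real n" by (simp add: add_pos_nonneg)
      then show ?thesis unfolding eL using n by (intro divide_left_mono power_mono) auto
    qed
    finally have "x \<le> 2 * (1 / (real n)\<^sup>2)"
      unfolding x_def by (intro mult_mono real_le_lsqrt) auto
    then have "real n * x \<le> real n * (2 * (1 / (real n)\<^sup>2))" by (intro mult_left_mono) auto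
    then show ?thesis using n by (simp add: power2_eq_square)
  qed
  moreover have "exp (- 2 * real n) \<le> 1 / n"
  proof -
    have "real n \<le> exp (2 * real n)" using exp_ge_add_one_self[of "2 * real n"] by linarith
    then show ?thesis using n by (simp add: exp_minus inverse_eq_divide divide_left_mono)
  qed
  ultimately have P: "1 - measure (sphere_measure n) A \<le> 3 / n"
    using sup_norm_small_ball_lower(1)[OF n L1] unfolding s_def[symmetric] x_def[symmetric] A_def[symmetric] by simp
  have int: "integrable (sphere_measure n) (sup_norm n)"
  proof -
    have "integrable (sphere_measure n) (\<lambda>\<theta>. sup_norm n \<theta> powr 1)" using n by (rule sup_norm_powr_integrable)
    also have "?this \<longleftrightarrow> integrable (sphere_measure n) (sup_norm n)"
    proof (rule Bochner_Integration.integrable_cong)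
      fix \<theta> assume "\<theta> \<in> space (sphere_measure n)"
      then have "0 < sup_norm n \<theta>" using sup_norm_sphere_pos[OF n] by (simp add: space_sphere_measure[OF n])
      then show "sup_norm n \<theta> powr 1 = sup_norm n \<theta>" by simp
    qed simp
    finally show ?thesis .
  qed
  have "(\<integral>\<theta>. sup_norm n \<theta> \<partial>sphere_measure n) \<le> (\<integral>\<theta>. s + (1 - indicator A \<theta>) \<partial>sphere_measure n)"
  proof (intro integral_mono int)
    fix \<theta> assume "\<theta> \<in> space (sphere_measure n)"
    then show "sup_norm n \<theta> \<le> s + (1 - indicator A \<theta>)"
      using sup_norm_sphere_bounds(2)[OF n, of \<theta>] s by (auto simp: space_sphere_measure[OF n] indicator_def A_def)
  qed (auto intro!: integrable_real_indicator simp: emeasure_eq_measure)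
  also have "\<dots> = s + (1 - measure (sphere_measure n) A)"
    by (simp add: prob_space emeasure_eq_measure)
  also have "\<dots> \<le> s + 3 / n" using P by simp
  also have "3 / n \<le> 3 * sqrt (L / n)"
  proof -
    have "1 / real n \<le> sqrt (1 / real n)"
      by (rule real_le_rsqrt) (use n in \<open>simp add: power2_eq_square divide_le_eq\<close>)
    also have "\<dots> \<le> sqrt (L / n)" using L1 by (intro real_sqrt_le_mono divide_right_mono) auto
    finally show ?thesis by simp
  qed
  finally show ?thesis by (simp add: s_def L_def distrib_right)
qed

text \<open>Jensen's inequality for a negative power, proved with the tangent at \<open>A\<close>.
  Its slope is negative, so an upper bound for the mean is enough, and no constant is lost however
  small \<open>p\<close> is.\<close>

lemma sup_norm_moment_lower_Jensen:
  assumes n: "0 < n" and p: "0 < p" and A: "0 < A" and le: "(\<integral>\<theta>. sup_norm n \<theta> \<partial>sphere_measure n) \<le> A"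
  shows "A powr (- p) \<le> (\<integral>\<theta>. sup_norm n \<theta> powr (- p) \<partial>sphere_measure n)"
proof -
  interpret prob_space "sphere_measure n" using n by (rule prob_space_sphere_measure)
  have I: "(\<integral>\<theta>. sup_norm n \<theta> \<partial>sphere_measure n) = (\<integral>\<theta>. sup_norm n \<theta> powr 1 \<partial>sphere_measure n)"
  proof (rule Bochner_Integration.integral_cong)
    fix \<theta> assume "\<theta> \<in> space (sphere_measure n)"
    then have "0 < sup_norm n \<theta>" using sup_norm_sphere_pos[OF n] by (simp add: space_sphere_measure[OF n])
    then show "sup_norm n \<theta> = sup_norm n \<theta> powr 1" by simp
  qed simp
  have int: "integrable (sphere_measure n) (\<lambda>\<theta>. sup_norm n \<theta> powr r)" for r
    using n by (rule sup_norm_powr_integrable)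
  have "A powr (- p) * 1 \<le> A powr (- p) * (1 - p * ((\<integral>\<theta>. sup_norm n \<theta> powr 1 \<partial>sphere_measure n) / A - 1))"
    using le A p unfolding I by (intro mult_left_mono) (auto simp: mult_le_0_iff)
  also have "\<dots> = (\<integral>\<theta>. A powr (- p) * (1 - p * (sup_norm n \<theta> powr 1 / A - 1)) \<partial>sphere_measure n)"
    by (simp add: int prob_space del: powr_one powr_one')
  also have "\<dots> \<le> (\<integral>\<theta>. sup_norm n \<theta> powr (- p) \<partial>sphere_measure n)"
  proof (intro integral_mono int)
    fix \<theta> assume "\<theta> \<in> space (sphere_measure n)"
    then have pos: "0 < sup_norm n \<theta>" using sup_norm_sphere_pos[OF n] by (simp add: space_sphere_measure[OF n])
    let ?y = "sup_norm n \<theta> / A"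
    have y: "0 < ?y" using pos A by simp
    \<comment> \<open>The tangent inequality y^(-p) >= 1 - p (y - 1) follows from ln y <= y - 1 and
      1 + z <= exp z.\<close>
    have "p * ln ?y \<le> p * (?y - 1)" using ln_le_minus_one[OF y] p by (intro mult_left_mono) auto
    then have "1 - p * (?y - 1) \<le> exp (- p * ln ?y)"
      using exp_ge_add_one_self[of "- p * ln ?y"] by simp
    also have "\<dots> = ?y powr (- p)" using pos A by (simp add: powr_def)
    finally have "A powr (- p) * (1 - p * (?y - 1)) \<le> A powr (- p) * ?y powr (- p)"
      by (intro mult_left_mono) auto
    also have "\<dots> = sup_norm n \<theta> powr (- p)"
      using pos A by (simp add: powr_divide)
    finally show "A powr (- p) * (1 - p * (sup_norm n \<theta> powr 1 / A - 1)) \<le> sup_norm n \<theta> powr (- p)"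
      using pos by simp
  qed (intro integrable_mult_right Bochner_Integration.integrable_diff integrable_divide int integrable_const)
  finally show ?thesis by simp
qed

theorem proposition5p7:
  "\<exists>c C :: real. c > 0 \<and> C > 0 \<and>
     (\<forall>(n::nat) (p::real). n \<ge> 2 \<longrightarrow> p > 0 \<longrightarrow>
        c * sqrt (ln (exp 1 + real n / (1 + p)) / real n) \<le> M_neg_cube n p \<and>
        M_neg_cube n p \<le> C * sqrt (ln (exp 1 + real n / (1 + p)) / real n))"
proof -
  \<comment> \<open>\<open>c\<close> is read off from (72/q n/L)^(p/2) = (c sqrt (L/n))^(-p) with q
    = \<open>gauss_tail_const\<close>. \<open>C1\<close> serves p >= 1 and \<open>C2\<close> serves
    p < 1, where its factor sqrt 2 pays for ln (e + n) <= 2 \<open>log_term n p\<close>; the sum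
    bounds both.\<close>
  define c where "c = sqrt (gauss_tail_const / 72)"
  define C1 where "C1 = exp 5 * sqrt 8 / small_ball_const"
  define C2 where "C2 = (sqrt 8 / small_ball_const + 3) * sqrt 2"
  have c: "0 < c" using gauss_tail_const_bounds by (simp add: c_def)
  have C: "0 < C1" "0 < C2" using small_ball_const_pos by (auto simp: C1_def C2_def add_pos_pos)
  have "c * sqrt (log_term n p / n) \<le> M_neg_cube n p \<and> M_neg_cube n p \<le> (C1 + C2) * sqrt (log_term n p / n)"
    if "n \<ge> 2" and p: "p > 0" for n :: nat and p :: real
  proof
    have n: "0 < n" using that by simp
    have L1: "1 \<le> log_term n p" using p by (rule log_term_bounds)
    let ?a = "sqrt (log_term n p / n)"
    have a: "0 < ?a" using n L1 by simp
    show "c * ?a \<le> M_neg_cube n p"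
    proof (rule M_neg_cube_ge[OF n p])
      show "0 < c * ?a" using c a by simp
      have "(72 / gauss_tail_const * n / log_term n p) powr (p / 2) = (gauss_tail_const / 72 * (log_term n p / n)) powr (- (p / 2))"
        using gauss_tail_const_bounds n L1 by (simp add: powr_minus_divide powr_divide powr_mult)
      also have "\<dots> = (c * ?a) powr (- p)"
        unfolding c_def real_sqrt_mult[symmetric] using gauss_tail_const_bounds L1 by (subst sqrt_powr) auto
      finally show "(\<integral>\<theta>. sup_norm n \<theta> powr (- p) \<partial>sphere_measure n) \<le> (c * ?a) powr (- p)"
        using sup_norm_moment_upper[OF n p] by simp
    qed
    show "M_neg_cube n p \<le> (C1 + C2) * ?a"
    proof (cases "1 \<le> p")
      case True
      have "M_neg_cube n p \<le> C1 * ?a"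
      proof (rule M_neg_cube_le[OF n p])
        show "0 < C1 * ?a" using C a by simp
        show "(C1 * ?a) powr (- p) \<le> (\<integral>\<theta>. sup_norm n \<theta> powr (- p) \<partial>sphere_measure n)"
          unfolding C1_def by (rule sup_norm_moment_lower_ge_1[OF n True])
      qed
      also have "\<dots> \<le> (C1 + C2) * ?a" using C a by (intro mult_right_mono) auto
      finally show ?thesis .
    next
      case False
      have "(\<integral>\<theta>. sup_norm n \<theta> \<partial>sphere_measure n) \<le> (sqrt 8 / small_ball_const + 3) * sqrt (ln (exp 1 + n) / n)"
        by (rule sup_norm_expectation_le[OF n])
      also have "\<dots> \<le> (sqrt 8 / small_ball_const + 3) * sqrt (2 * (log_term n p / n))"
        using log_term_le_double(2)[of p n] p False small_ball_const_pos
        by (intro mult_left_mono real_sqrt_le_mono) (auto simp: divide_right_mono)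
      also have "\<dots> = C2 * ?a" unfolding C2_def real_sqrt_mult by simp
      finally have "M_neg_cube n p \<le> C2 * ?a"
        using C a by (intro M_neg_cube_le sup_norm_moment_lower_Jensen n p) auto
      also have "\<dots> \<le> (C1 + C2) * ?a" using C a by (intro mult_right_mono) auto
      finally show ?thesis .
    qed
  qed
  then show ?thesis
    using c C unfolding log_term_def by (intro exI[of _ c] exI[of _ "C1 + C2"]) auto
qed

end
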